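(* Let $\mathcal{R}=\{W_w,V_{w,v},\Lambda_w,\alpha_{w,v}\}_{w\in\Omega,v\in\Omega_w}$ be a continuous relay fusion frame for $H$. Let $\mathcal{F}_{\mathcal{K}}$ be a frame for the global relay space $\mathcal{K}=\big(\int_\Omega\oplus K_w\big)_{l^2}$ with frame operator $S_{\mathcal{F}_{\mathcal{K}}}$, where each $K_w$ is regarded as a closed subspace of $\mathcal{K}$. Put $\widetilde{V}_{w,v}=S_{\mathcal{F}_{\mathcal{K}}}^{-1}V_{w,v}$ and $\widetilde{\Lambda}_{w,v}=S_{\mathcal{F}_{\mathcal{K}}}^{-1}P_{V_{w,v}}\Lambda_w$. Then $\widetilde{\mathcal{R}}=\{W_w,\widetilde{V}_{w,v},\widetilde{\Lambda}_{w,v},\alpha_{w,v}\}_{w\in\Omega,v\in\Omega_w}$ is a continuous relay fusion frame for $H$, and, with $S_{\widetilde{\mathcal{R}}}$ denoting its frame operator, for all $f\in H$, $$f=\int_\Omega\int_{\Omega_w}\alpha_{w,v}^2S_{\widetilde{\mathcal{R}}}^{-1}\pi_{W_w}\widetilde{\Lambda}_{w,v}^{*}\widetilde{\Lambda}_{w,v}\pi_{W_w}f\,d\mu(v)\,d\mu(w)=\int_\Omega\int_{\Omega_w}\alpha_{w,v}^2\pi_{W_w}\widetilde{\Lambda}_{w,v}^{*}\widetilde{\Lambda}_{w,v}\pi_{W_w}S_{\widetilde{\mathcal{R}}}^{-1}f\,d\mu(v)\,d\mu(w).$$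
   Context: Setting. $H$ is a separable Hilbert space and $(\Omega,\mu)$ is a positive measure space; for each $w\in\Omega$, $\Omega_w$ is a positive measure space whose measure is also denoted $\mu$. For each $w\in\Omega$, $K_w$ is a separable Hilbert space, $W_w\subseteq H$ is a closed subspace, $\Lambda_w\in B(H,K_w)$, and $\{V_{w,v}\}_{v\in\Omega_w}$ is a family of closed subspaces of $K_w$; $\alpha_{w,v}>0$ are weights. $\pi_W$ and $P_V$ denote orthogonal projections onto closed subspaces $W$ of $H$ and $V$ of the relay space. Families are understood to be measurable so that the integrals written make sense; vector-valued integrals are understood weakly. Definition. $\mathcal{R}=\{W_w,V_{w,v},\Lambda_w,\alpha_{w,v}\}_{w\in\Omega,v\in\Omega_w}$ is a continuous relay fusion frame for $H$ with bounds $A,B$ if: (1) for each $f\in H$, $\{\Lambda_wf\}_{w\in\Omega}$ is strongly measurable; (2) for each $f\in H$, $\{\pi_{W_w}f\}_{w\in\Omega}$ is strongly measurable; (3) for each $f\in K_w$, $\{P_{V_{w,v}}f\}_{w\in\Omega,v\in\Omega_w}$ is strongly measurable; (4) there are constants $0<A\le B<\infty$ such that $$A\|f\|^2\le\int_\Omega\int_{\Omega_w}\alpha_{w,v}^2\|P_{V_{w,v}}\Lambda_w\pi_{W_w}f\|^2\,d\mu(v)\,d\mu(w)\le B\|f\|^2\quad\forall f\in H.$$ Its frame operator is $S_{\mathcal{R}}f=\int_\Omega\int_{\Omega_w}\alpha_{w,v}^2\pi_{W_w}\Lambda_w^*P_{V_{w,v}}\Lambda_w\pi_{W_w}f\,d\mu(v)\,d\mu(w)$.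 The same definitions are applied to $\widetilde{\mathcal{R}}$ with $\widetilde{V}_{w,v}\subseteq\mathcal{K}$ and $\widetilde{\Lambda}_{w,v}\in B(H,\mathcal{K})$ in place of $V_{w,v}\subseteq K_w$ and $\Lambda_w$ (the relay space being $\mathcal{K}$). $\mathcal{K}=\big(\int_\Omega\oplus K_w\big)_{l^2}$ is the Hilbert space of families $\{f_w\}_{w\in\Omega}$, $f_w\in K_w$, with $\int_\Omega\|f_w\|^2d\mu(w)<\infty$ and inner product $\int_\Omega\langle f_w,g_w\rangle d\mu(w)$. The identification of each $K_w$ with a closed subspace of $\mathcal{K}$ (an isometric embedding) is part of the data. The frame operator of a frame is a bounded, positive, invertible operator on the space. *)

theory Defs
  imports "HOL-Analysis.Analysis"
begin

text \<open>
  The scalar field is either the reals or the complex numbers. By Gelfand--Mazur these are, up to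
  isomorphism, the only fields in the following class.
\<close>

class real_or_complex = real_normed_field + banach + second_countable_topology +
  fixes conjg :: "'a \<Rightarrow> 'a"
  assumes conjg_add: "conjg (x + y) = conjg x + conjg y"
    and conjg_mult: "conjg (x * y) = conjg x * conjg y"
    and conjg_conjg: "conjg (conjg x) = x"
    and mult_conjg: "x * conjg x = (norm x)\<^sup>2 *\<^sub>R 1"

instantiation real :: real_or_complex
begin
definition conjg_real :: "real \<Rightarrow> real" where "conjg_real x = x"
instance by standard (simp_all add: conjg_real_def power2_eq_square)
end

instantiation complex :: real_or_complex
begin
definition conjg_complex :: "complex \<Rightarrow> complex" where "conjg_complex x = cnj x"
instance
  by standard (simp_all add: conjg_complex_def complex_mult_cnj cmod_power2 scaleR_conv_of_real)
end

text \<open>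
  Completeness is the class \<open>banach\<close>; the inner product is linear in its first argument.
\<close>

locale hilbert_space = vector_space scl
  for scl :: "'k::real_or_complex \<Rightarrow> 'a::banach \<Rightarrow> 'a" +
  fixes ip :: "'a \<Rightarrow> 'a \<Rightarrow> 'k"
  assumes scale_of_real: "scl (of_real r) x = r *\<^sub>R x"
    and ip_add_left: "ip (x + y) z = ip x z + ip y z"
    and ip_scale_left: "ip (scl c x) y = c * ip x y"
    and ip_commute: "ip y x = conjg (ip x y)"
    and ip_self: "ip x x = of_real ((norm x)\<^sup>2)"

definition closed_subspace ::
    "('k::real_or_complex \<Rightarrow> 'a::banach \<Rightarrow> 'a) \<Rightarrow> 'a set \<Rightarrow> bool" where
  "closed_subspace scl W \<longleftrightarrow> module.subspace scl W \<and> closed W"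

definition bounded_op ::
    "('k::real_or_complex \<Rightarrow> 'a::banach \<Rightarrow> 'a) \<Rightarrow> ('k \<Rightarrow> 'b::banach \<Rightarrow> 'b) \<Rightarrow> ('a \<Rightarrow> 'b) \<Rightarrow> bool" where
  "bounded_op s1 s2 T \<longleftrightarrow> Vector_Spaces.linear s1 s2 T \<and> (\<exists>C. \<forall>x. norm (T x) \<le> C * norm x)"

definition orth_proj :: "('a::banach \<Rightarrow> 'a \<Rightarrow> 'k::real_or_complex) \<Rightarrow> 'a set \<Rightarrow> 'a \<Rightarrow> 'a" where
  "orth_proj ip W x = (THE y. y \<in> W \<and> (\<forall>z\<in>W. ip (x - y) z = 0))"

definition adj ::
    "('a::banach \<Rightarrow> 'a \<Rightarrow> 'k::real_or_complex) \<Rightarrow> ('b::banach \<Rightarrow> 'b \<Rightarrow> 'k) \<Rightarrow> ('a \<Rightarrow> 'b) \<Rightarrow> 'b \<Rightarrow> 'a" where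
  "adj ip1 ip2 T = (THE T'. \<forall>x y. ip2 (T x) y = ip1 x (T' y))"

text \<open>The sums are unconditional; the index set is arbitrary.\<close>

definition hilbert_frame ::
    "('a::banach \<Rightarrow> 'a \<Rightarrow> 'k::real_or_complex) \<Rightarrow> 'i set \<Rightarrow> ('i \<Rightarrow> 'a) \<Rightarrow> bool" where
  "hilbert_frame ip I \<phi> \<longleftrightarrow>
    (\<exists>A B. 0 < A \<and> A \<le> B \<and>
      (\<forall>x. (\<lambda>i. (norm (ip x (\<phi> i)))\<^sup>2) summable_on I \<and>
           A * (norm x)\<^sup>2 \<le> (\<Sum>\<^sub>\<infinity>i\<in>I. (norm (ip x (\<phi> i)))\<^sup>2) \<and>
           (\<Sum>\<^sub>\<infinity>i\<in>I. (norm (ip x (\<phi> i)))\<^sup>2) \<le> B * (norm x)\<^sup>2))"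

definition frame_operator ::
    "('k::real_or_complex \<Rightarrow> 'a::banach \<Rightarrow> 'a) \<Rightarrow> ('a \<Rightarrow> 'a \<Rightarrow> 'k) \<Rightarrow> 'i set \<Rightarrow> ('i \<Rightarrow> 'a) \<Rightarrow> 'a \<Rightarrow> 'a" where
  "frame_operator scl ip I \<phi> x = (\<Sum>\<^sub>\<infinity>i\<in>I. scl (ip x (\<phi> i)) (\<phi> i))"

definition strongly_measurable :: "'w measure \<Rightarrow> ('w \<Rightarrow> 'a::metric_space) \<Rightarrow> bool" where
  "strongly_measurable M f \<longleftrightarrow>
    (\<exists>s. (\<forall>n::nat. simple_function M (s n)) \<and> (\<forall>x\<in>space M. (\<lambda>n. s n x) \<longlonglongrightarrow> f x))"

text \<open>
  \<open>\<Omega>\<close> is \<open>M\<close> and \<open>\<Omega>\<^sub>w\<close> is \<open>N w\<close>. Families indexed by both \<open>w \<in> \<Omega>\<close> and \<open>v \<in> \<Omega>\<^sub>w\<close> are functions on the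
  disjoint union of the \<open>\<Omega>\<^sub>w\<close>. Their measurability refers to a sigma-algebra on that union (that of
  \<open>T\<close>, whose measure is irrelevant) for which iterated integrals of nonnegative measurable
  functions make sense. If all \<open>N w\<close> are the same sigma-finite measure, the product sigma-algebra
  qualifies; if \<open>\<Omega>\<close> is countable and discrete, the disjoint-union sigma-algebra does.
\<close>

definition measurable_bundle ::
    "'w measure \<Rightarrow> ('w \<Rightarrow> 'v measure) \<Rightarrow> ('w \<times> 'v) measure \<Rightarrow> bool" where
  "measurable_bundle M N T \<longleftrightarrow>
    space T = (SIGMA w:space M. space (N w)) \<and>
    fst \<in> T \<rightarrow>\<^sub>M M \<and>
    (\<forall>g \<in> borel_measurable T. \<forall>w\<in>space M. (\<lambda>v. g (w, v) :: ennreal) \<in> borel_measurable (N w)) \<and>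
    (\<forall>g \<in> borel_measurable T. (\<lambda>w. \<integral>\<^sup>+v. (g (w, v) :: ennreal) \<partial>N w) \<in> borel_measurable M)"

text \<open>\<open>x = \<integral>\<integral> F w v dN\<^sub>w(v) dM(w)\<close> in the weak sense, including existence of the integral.\<close>

definition has_weak_integral ::
    "'w measure \<Rightarrow> ('w \<Rightarrow> 'v measure) \<Rightarrow> ('a::banach \<Rightarrow> 'a \<Rightarrow> 'k::real_or_complex) \<Rightarrow>
     ('w \<Rightarrow> 'v \<Rightarrow> 'a) \<Rightarrow> 'a \<Rightarrow> bool" where
  "has_weak_integral M N ip F x \<longleftrightarrow>
    (\<forall>g. (AE w in M. integrable (N w) (\<lambda>v. ip (F w v) g)) \<and>
         integrable M (\<lambda>w. LINT v|N w. ip (F w v) g) \<and>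
         (LINT w|M. LINT v|N w. ip (F w v) g) = ip x g)"

text \<open>
  The spaces \<open>K w\<close> are given through their embeddings, i.e. as closed subspaces of the Hilbert space
  \<open>'r\<close>, which is the global relay space: \<open>U\<close> is the unitary identification of the square-integrable
  measurable families \<open>{f\<^sub>w}\<close>, \<open>f\<^sub>w \<in> K w\<close>, modulo null sets, with \<open>'r\<close>. (By preservation of the inner
  product, \<open>U\<close> automatically identifies families exactly if they agree almost everywhere.)
  The inclusion of \<open>K w\<close> in \<open>'r\<close> and the map \<open>U\<close> are independent data.
\<close>

definition l2_families ::
    "'w measure \<Rightarrow> ('w \<Rightarrow> 'r::banach set) \<Rightarrow> ('w \<Rightarrow> 'r) set" where
  "l2_families M K = {f. (\<forall>w\<in>space M. f w \<in> K w) \<and> strongly_measurable M f \<and>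
     (\<integral>\<^sup>+w. ennreal ((norm (f w))\<^sup>2) \<partial>M) < \<infinity>}"

definition direct_integral ::
    "'w measure \<Rightarrow> ('k::real_or_complex \<Rightarrow> 'r::banach \<Rightarrow> 'r) \<Rightarrow> ('r \<Rightarrow> 'r \<Rightarrow> 'k) \<Rightarrow>
     ('w \<Rightarrow> 'r set) \<Rightarrow> (('w \<Rightarrow> 'r) \<Rightarrow> 'r) \<Rightarrow> bool" where
  "direct_integral M scl ip K U \<longleftrightarrow>
    (\<forall>w\<in>space M. closed_subspace scl (K w) \<and>
       (\<exists>D. countable D \<and> D \<subseteq> K w \<and> K w \<subseteq> closure D)) \<and>
    (\<forall>x. strongly_measurable M (\<lambda>w. orth_proj ip (K w) x)) \<and>
    (\<forall>f\<in>l2_families M K. \<forall>g\<in>l2_families M K. U (\<lambda>w. f w + g w) = U f + U g) \<and>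
    (\<forall>c. \<forall>f\<in>l2_families M K. U (\<lambda>w. scl c (f w)) = scl c (U f)) \<and>
    (\<forall>f\<in>l2_families M K. \<forall>g\<in>l2_families M K. ip (U f) (U g) = (LINT w|M. ip (f w) (g w))) \<and>
    U ` l2_families M K = UNIV"

text \<open>
  Version with operators \<open>\<Lambda> w v\<close> indexed by both \<open>w\<close> and \<open>v\<close>. In the measurability condition on the
  projections to \<open>V w v\<close> the vector \<open>x\<close> ranges
  over the whole space \<open>'r\<close> containing the \<open>K w\<close>; since \<open>V w v \<subseteq> K w\<close>, the projection of \<open>x\<close> to \<open>V w v\<close>
  is that of its component in \<open>K w\<close>.
\<close>

definition relay_fusion_frame2 ::
    "('k::real_or_complex \<Rightarrow> 'h::banach \<Rightarrow> 'h) \<Rightarrow> ('h \<Rightarrow> 'h \<Rightarrow> 'k) \<Rightarrow>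
     ('k \<Rightarrow> 'r::banach \<Rightarrow> 'r) \<Rightarrow> ('r \<Rightarrow> 'r \<Rightarrow> 'k) \<Rightarrow>
     'w measure \<Rightarrow> ('w \<Rightarrow> 'v measure) \<Rightarrow> ('w \<times> 'v) measure \<Rightarrow> ('w \<Rightarrow> 'r set) \<Rightarrow>
     ('w \<Rightarrow> 'h set) \<Rightarrow> ('w \<Rightarrow> 'v \<Rightarrow> 'r set) \<Rightarrow> ('w \<Rightarrow> 'v \<Rightarrow> 'h \<Rightarrow> 'r) \<Rightarrow> ('w \<Rightarrow> 'v \<Rightarrow> real) \<Rightarrow> bool" where
  "relay_fusion_frame2 scH ipH scK ipK M N T K W V \<Lambda> \<alpha> \<longleftrightarrow>
    (\<forall>w\<in>space M. closed_subspace scH (W w) \<and> closed_subspace scK (K w)) \<and>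
    (\<forall>w\<in>space M. \<forall>v\<in>space (N w).
       closed_subspace scK (V w v) \<and> V w v \<subseteq> K w \<and>
       bounded_op scH scK (\<Lambda> w v) \<and> range (\<Lambda> w v) \<subseteq> K w \<and> 0 < \<alpha> w v) \<and>
    (\<lambda>(w, v). \<alpha> w v) \<in> borel_measurable T \<and>
    (\<forall>f. strongly_measurable T (\<lambda>(w, v). \<Lambda> w v f)) \<and>
    (\<forall>f. strongly_measurable M (\<lambda>w. orth_proj ipH (W w) f)) \<and>
    (\<forall>x. strongly_measurable T (\<lambda>(w, v). orth_proj ipK (V w v) x)) \<and>
    (\<exists>A B. 0 < A \<and> A \<le> B \<and> (\<forall>f.
       ennreal (A * (norm f)\<^sup>2) \<le>
         (\<integral>\<^sup>+w. \<integral>\<^sup>+v. ennreal ((\<alpha> w v)\<^sup>2 *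
            (norm (orth_proj ipK (V w v) (\<Lambda> w v (orth_proj ipH (W w) f))))\<^sup>2) \<partial>N w \<partial>M) \<and>
       (\<integral>\<^sup>+w. \<integral>\<^sup>+v. ennreal ((\<alpha> w v)\<^sup>2 *
            (norm (orth_proj ipK (V w v) (\<Lambda> w v (orth_proj ipH (W w) f))))\<^sup>2) \<partial>N w \<partial>M)
         \<le> ennreal (B * (norm f)\<^sup>2)))"

definition relay_fusion_frame ::
    "('k::real_or_complex \<Rightarrow> 'h::banach \<Rightarrow> 'h) \<Rightarrow> ('h \<Rightarrow> 'h \<Rightarrow> 'k) \<Rightarrow>
     ('k \<Rightarrow> 'r::banach \<Rightarrow> 'r) \<Rightarrow> ('r \<Rightarrow> 'r \<Rightarrow> 'k) \<Rightarrow>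
     'w measure \<Rightarrow> ('w \<Rightarrow> 'v measure) \<Rightarrow> ('w \<times> 'v) measure \<Rightarrow> ('w \<Rightarrow> 'r set) \<Rightarrow>
     ('w \<Rightarrow> 'h set) \<Rightarrow> ('w \<Rightarrow> 'v \<Rightarrow> 'r set) \<Rightarrow> ('w \<Rightarrow> 'h \<Rightarrow> 'r) \<Rightarrow> ('w \<Rightarrow> 'v \<Rightarrow> real) \<Rightarrow> bool" where
  "relay_fusion_frame scH ipH scK ipK M N T K W V \<Lambda> \<alpha> \<longleftrightarrow>
    (\<forall>w\<in>space M. bounded_op scH scK (\<Lambda> w) \<and> range (\<Lambda> w) \<subseteq> K w) \<and>
    (\<forall>f. strongly_measurable M (\<lambda>w. \<Lambda> w f)) \<and>
    relay_fusion_frame2 scH ipH scK ipK M N T K W V (\<lambda>w v. \<Lambda> w) \<alpha>"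

definition relay_frame_integrand ::
    "('h::banach \<Rightarrow> 'h \<Rightarrow> 'k::real_or_complex) \<Rightarrow> ('r::banach \<Rightarrow> 'r \<Rightarrow> 'k) \<Rightarrow>
     ('w \<Rightarrow> 'h set) \<Rightarrow> ('w \<Rightarrow> 'v \<Rightarrow> 'r set) \<Rightarrow> ('w \<Rightarrow> 'v \<Rightarrow> 'h \<Rightarrow> 'r) \<Rightarrow> ('w \<Rightarrow> 'v \<Rightarrow> real) \<Rightarrow>
     'h \<Rightarrow> 'w \<Rightarrow> 'v \<Rightarrow> 'h" where
  "relay_frame_integrand ipH ipK W V \<Lambda> \<alpha> f w v =
    (\<alpha> w v)\<^sup>2 *\<^sub>R orth_proj ipH (W w) (adj ipH ipK (\<Lambda> w v)
      (orth_proj ipK (V w v) (\<Lambda> w v (orth_proj ipH (W w) f))))"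

definition relay_frame_operator ::
    "('h::banach \<Rightarrow> 'h \<Rightarrow> 'k::real_or_complex) \<Rightarrow> ('r::banach \<Rightarrow> 'r \<Rightarrow> 'k) \<Rightarrow>
     'w measure \<Rightarrow> ('w \<Rightarrow> 'v measure) \<Rightarrow>
     ('w \<Rightarrow> 'h set) \<Rightarrow> ('w \<Rightarrow> 'v \<Rightarrow> 'r set) \<Rightarrow> ('w \<Rightarrow> 'v \<Rightarrow> 'h \<Rightarrow> 'r) \<Rightarrow> ('w \<Rightarrow> 'v \<Rightarrow> real) \<Rightarrow>
     'h \<Rightarrow> 'h" where
  "relay_frame_operator ipH ipK M N W V \<Lambda> \<alpha> f =
    (THE x. has_weak_integral M N ipH (relay_frame_integrand ipH ipK W V \<Lambda> \<alpha> f) x)"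

end

theory Submission
  imports Defs
begin

text \<open>
  Absorb the weights into \<open>L w v = \<alpha> w v \<Lambda>'\<^sub>w\<^sub>v \<pi>\<^sub>W\<^sub>w\<close>. Since \<open>S\<^sub>F\<close> is bounded, self-adjoint and bounded below,
  so is its inverse, and \<open>norm (L w v f)\<close> is comparable to the norm in the frame condition for
  \<open>\<R>\<close>; the frame bounds carry over. As \<open>\<Lambda>'\<close> takes its values in \<open>V'\<close>, the projection to \<open>V'\<close> drops out
  of the integrand, and the frame operator represents the form \<open>(f, g) \<mapsto> \<integral>\<integral> \<langle>L w v f, L w v g\<rangle>\<close>, which
  is bounded and coercive. Hence \<open>S'\<close> is bijective, and both reconstruction formulas arise
  from its weak integral by moving \<open>S'\<^sup>-\<^sup>1\<close> to \<open>g\<close> or to \<open>f\<close>. The delicate point is measurability,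
  for which \<open>'r\<close> need not be separable, in particular that of the projections to \<open>S\<^sub>F\<^sup>-\<^sup>1 V\<close>.
\<close>

subsection \<open>Scalars\<close>

text \<open>Three obstacles shape what follows. The inverse frame operator is not unitary, so
  conjugating the projection onto V by it gives in general only an oblique projection onto the image
  of V; the orthogonal one has to be reached by an iteration built from measurable ingredients. On a
  nonseparable space the Borel sets of a product can exceed the product sigma-algebra, so continuity
  in two variables does not by itself make an inner product of measurable families measurable; such
  compositions are treated one variable at a time and with separable ranges under control. Finally,
  the bundle \<open>T\<close> speaks only about nonnegative functions, so iterated integrals of
  scalar functions must be built from them, with attention to the value 0 that the integral takes on
  functions that are not integrable. Since \<open>adj\<close>, \<open>orth_proj\<close> and the
  frame operator are definite descriptions, each also needs existence and uniqueness before it can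
  be used.\<close>

lemma conjg_0 [simp]: "conjg (0::'k::real_or_complex) = 0"
  using conjg_add[of "0::'k" 0] by simp

lemma conjg_minus: "conjg (- x :: 'k::real_or_complex) = - conjg x"
  using conjg_add[of x "- x"] by (simp add: eq_neg_iff_add_eq_0 add.commute)

lemma conjg_diff: "conjg (x - y :: 'k::real_or_complex) = conjg x - conjg y"
  using conjg_add[of x "- y"] by (simp add: conjg_minus)

lemma conjg_of_real [simp]: "conjg (of_real r :: 'k::real_or_complex) = of_real r"
proof (cases "r = 0")
  case False
  have "(of_real r :: 'k) * conjg (of_real r) = of_real r * of_real r"
    using mult_conjg[of "of_real r :: 'k"] by (simp add: scaleR_conv_of_real power2_eq_square)
  then show ?thesis using False by simp
qed simp

lemma mult_conjg_of_real: "x * conjg x = (of_real ((norm x)\<^sup>2) :: 'k::real_or_complex)"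
  using mult_conjg[of x] by (simp add: scaleR_conv_of_real)

lemma norm_conjg [simp]: "norm (conjg x :: 'k::real_or_complex) = norm x"
proof (cases "x = 0")
  case False
  have "norm x * norm (conjg x) = (norm x)\<^sup>2"
    by (metis mult_conjg_of_real norm_mult norm_of_real abs_of_nonneg zero_le_power2)
  then show ?thesis using False by (simp add: power2_eq_square)
qed simp

lemma bounded_linear_conjg: "bounded_linear (conjg :: 'k::real_or_complex \<Rightarrow> 'k)"
proof (rule bounded_linear_intro[where K = 1])
  fix r and x :: 'k
  show "conjg (r *\<^sub>R x) = r *\<^sub>R conjg x"
    by (simp add: scaleR_conv_of_real conjg_mult)
qed (simp_all add: conjg_add)

text \<open>Expansion of \<open>(x + 1) * conjg (x + 1)\<close> by \<open>mult_conjg\<close>. No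
  axiom of the class says that \<open>x + conjg x\<close> is real; this polarisation exhibits the
  real number, and half of it serves as the real part below.\<close>

lemma add_conjg_of_real:
  "x + conjg x = (of_real ((norm (x + 1))\<^sup>2 - (norm x)\<^sup>2 - 1) :: 'k::real_or_complex)"
proof -
  have one: "conjg (1::'k) = 1" using conjg_of_real[of 1] by simp
  have "(x + 1) * (conjg x + 1) = of_real ((norm (x + 1))\<^sup>2)"
    using mult_conjg_of_real[of "x + 1"] by (simp only: conjg_add one)
  then show ?thesis
    using mult_conjg_of_real[of x] by (simp add: algebra_simps)
qed

text \<open>
  Lets Bochner integrals of scalar functions be reduced to real ones. It is the elementary half of
  Gelfand--Mazur: elements with \<open>conjg x = - x\<close> are real multiples of any nonzero one among them.
\<close>

lemma scalar_decomposition: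
  obtains re im :: "'k::real_or_complex \<Rightarrow> real" and j :: 'k
  where "bounded_linear re" "bounded_linear im" "\<And>x. x = of_real (re x) + of_real (im x) * j"
proof -
  define re where "re x = ((norm (x + 1))\<^sup>2 - (norm x)\<^sup>2 - 1) / 2" for x :: 'k
  have re: "of_real (re x) = (x + conjg x) / 2" for x :: 'k
    by (simp add: re_def add_conjg_of_real)
  \<comment> \<open>Identities for \<open>re\<close> are checked after embedding the reals into the
    field, where \<open>re x\<close> is half of \<open>x + conjg x\<close>.\<close>
  have eqI: "r = s" if "(of_real r :: 'k) = of_real s" for r s using that by simp
  have bl: "bounded_linear (re :: 'k \<Rightarrow> real)"
  proof (rule bounded_linear_intro[where K = 1])
    fix x y :: 'k and r
    show "re (x + y) = re x + re y"
      by (rule eqI) (simp add: re conjg_add field_simps)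
    show "re (r *\<^sub>R x) = r *\<^sub>R re x"
      by (rule eqI) (simp add: re scaleR_conv_of_real conjg_mult field_simps)
    have "norm (of_real (re x) :: 'k) \<le> (norm x + norm (conjg x)) / 2"
      unfolding re by (simp add: norm_divide norm_triangle_ineq del: norm_conjg)
    then show "norm (re x) \<le> norm x * 1" by simp
  qed
  show ?thesis
  proof (cases "\<exists>j::'k. j \<noteq> 0 \<and> conjg j = - j")
    case True
    then obtain j :: 'k where j: "j \<noteq> 0" "conjg j = - j" by blast
    \<comment> \<open>Dividing by the skew element j exchanges self-conjugate and skew elements, so
      the coefficient of the skew part is a real part again.\<close>
    define im where "im x = re (x / j)" for x :: 'k
    have cj: "conjg (x / j) = - conjg x / j" for x
    proof -
      have "conjg (x / j) * conjg j = conjg x"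
        using j(1) conjg_mult[of "x / j" j] by simp
      then show ?thesis using j by (simp add: nonzero_eq_divide_eq minus_equation_iff)
    qed
    have "x = of_real (re x) + of_real (im x) * j" for x
      using j(1) by (simp add: im_def re cj field_simps)
    moreover have "bounded_linear im"
      unfolding im_def divide_inverse
      by (rule bounded_linear_compose[OF bl bounded_linear_mult_left])
    ultimately show ?thesis using that bl by blast
  next
    case False
    \<comment> \<open>Without nonzero skew elements every scalar is self-conjugate, hence real; the
      imaginary part and j are filled with 0.\<close>
    have "x = of_real (re x) + of_real 0 * 0" for x :: 'k
    proof -
      have "conjg (x - conjg x) = - (x - conjg x)" by (simp add: conjg_diff conjg_conjg)
      then have "x = conjg x" using False by (metis right_minus_eq)
      then show ?thesis by (simp add: re)
    qed
    then show ?thesis using that[OF bl bounded_linear_zero] by blast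
  qed
qed

subsection \<open>Hilbert spaces\<close>

context hilbert_space
begin

lemma scaleR_eq: "r *\<^sub>R x = scl (of_real r) x"
  by (simp add: scale_of_real)

lemma ip_add_right: "ip x (y + z) = ip x y + ip x z"
  by (metis conjg_add ip_add_left ip_commute)

lemma ip_scale_right: "ip x (scl c y) = conjg c * ip x y"
  by (metis conjg_mult ip_commute ip_scale_left)

lemma ip_scaleR_left: "ip (r *\<^sub>R x) y = r *\<^sub>R ip x y"
  by (simp add: scaleR_eq ip_scale_left scaleR_conv_of_real)

lemma ip_scaleR_right: "ip x (r *\<^sub>R y) = r *\<^sub>R ip x y"
  by (simp add: scaleR_eq ip_scale_right scaleR_conv_of_real)

lemma ip_zero_left [simp]: "ip 0 y = 0"
  using ip_scaleR_left[of 0 0 y] by simp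

lemma ip_zero_right [simp]: "ip x 0 = 0"
  using ip_scaleR_right[of x 0 0] by simp

lemma ip_diff_left: "ip (x - y) z = ip x z - ip y z"
  by (metis add_diff_cancel diff_add_cancel ip_add_left)

lemma ip_diff_right: "ip x (y - z) = ip x y - ip x z"
  by (metis add_diff_cancel diff_add_cancel ip_add_right)

lemma ip_sum_left: "ip (sum f F) y = (\<Sum>i\<in>F. ip (f i) y)"
  by (induction F rule: infinite_finite_induct) (simp_all add: ip_add_left)

lemma ip_eq_0_commute: "ip x y = 0 \<longleftrightarrow> ip y x = 0"
  by (metis conjg_0 ip_commute)

lemma ip_self_eq_0: "ip x x = 0 \<Longrightarrow> x = 0"
  by (simp add: ip_self)

lemma ip_eqI: "(\<And>z. ip x z = ip y z) \<Longrightarrow> x = y"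
  by (metis ip_diff_left ip_self_eq_0 right_minus_eq)

lemma norm_ip_self [simp]: "norm (ip x x) = (norm x)\<^sup>2"
  by (simp add: ip_self norm_power)

text \<open>The locale ties \<open>scl\<close> to the norm directly only for real scalars; the
  general case has to come from the inner product.\<close>

lemma norm_scl: "norm (scl c x) = norm c * norm x"
proof -
  have "ip (scl c x) (scl c x) = (c * conjg c) * ip x x"
    by (simp add: ip_scale_left ip_scale_right)
  also have "\<dots> = of_real ((norm c * norm x)\<^sup>2)"
    by (simp add: mult_conjg_of_real ip_self power_mult_distrib)
  finally have "(norm (scl c x))\<^sup>2 = (norm c * norm x)\<^sup>2"
    unfolding ip_self of_real_eq_iff .
  then show ?thesis by simp
qed

lemma bounded_linear_scl: "bounded_linear (scl c)"
  by (rule bounded_linear_intro[where K = "norm c"])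
    (simp_all add: scale_right_distrib scaleR_eq mult.commute norm_scl del: scale_of_real)

lemma Pythagoras:
  assumes "ip x y = 0"
  shows "(norm (x + y))\<^sup>2 = (norm x)\<^sup>2 + (norm y)\<^sup>2"
proof -
  have "ip (x + y) (x + y) = ip x x + ip y y"
    using assms by (simp add: ip_add_left ip_add_right ip_eq_0_commute[of y x])
  then have "(of_real ((norm (x + y))\<^sup>2) :: 'k) = of_real ((norm x)\<^sup>2 + (norm y)\<^sup>2)"
    unfolding ip_self by simp
  then show ?thesis unfolding of_real_eq_iff .
qed

lemma parallelogram:
  fixes x y :: 'a
  shows "(norm (x + y))\<^sup>2 + (norm (x - y))\<^sup>2 = 2 * (norm x)\<^sup>2 + 2 * (norm y)\<^sup>2"
proof -
  have "ip (x + y) (x + y) + ip (x - y) (x - y) = 2 * ip x x + 2 * ip y y"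
    by (simp add: ip_add_left ip_add_right ip_diff_left ip_diff_right)
  then have "(of_real ((norm (x + y))\<^sup>2 + (norm (x - y))\<^sup>2) :: 'k)
      = of_real (2 * (norm x)\<^sup>2 + 2 * (norm y)\<^sup>2)"
    unfolding ip_self by simp
  then show ?thesis unfolding of_real_eq_iff .
qed

lemma ip_remainder:
  assumes "y \<noteq> 0"
  shows "ip (x - scl (ip x y / of_real ((norm y)\<^sup>2)) y) y = 0"
  using assms by (simp add: ip_diff_left ip_scale_left ip_self)

text \<open>Pythagoras for x split along y, the parallel component having length
  \<open>norm (ip x y) / norm y\<close>. Dropping the remainder gives Cauchy-Schwarz; comparing it
  with x shows that nearest points are orthogonal.\<close>

lemma norm_sq_remainder:
  assumes "y \<noteq> 0"
  shows "(norm x)\<^sup>2 = (norm (x - scl (ip x y / of_real ((norm y)\<^sup>2)) y))\<^sup>2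
    + (norm (ip x y) / norm y)\<^sup>2"
proof -
  let ?c = "ip x y / of_real ((norm y)\<^sup>2)"
  have "ip (x - scl ?c y) (scl ?c y) = 0"
    unfolding ip_scale_right ip_remainder[OF assms] by simp
  from Pythagoras[OF this] show ?thesis
    using assms by (simp add: norm_scl norm_divide norm_mult power2_eq_square[of "norm y"])
qed

lemma Cauchy_Schwarz: "norm (ip x y) \<le> norm x * norm y"
proof (cases "y = 0")
  case False
  have "(norm (ip x y) / norm y)\<^sup>2 \<le> (norm x)\<^sup>2"
    using norm_sq_remainder[OF False, of x] by simp
  then have "norm (ip x y) / norm y \<le> norm x" by (rule power2_le_imp_le) simp
  then show ?thesis using False by (simp add: field_simps)
qed simp

lemma bounded_bilinear_ip: "bounded_bilinear ip"
  by unfold_locales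
    (auto simp: ip_add_left ip_add_right ip_scaleR_left ip_scaleR_right intro!: exI[of _ 1] Cauchy_Schwarz)

lemmas bounded_linear_ip_left = bounded_bilinear.bounded_linear_left[OF bounded_bilinear_ip]
lemmas bounded_linear_ip_right = bounded_bilinear.bounded_linear_right[OF bounded_bilinear_ip]

subsection \<open>Orthogonal projections\<close>

lemma closed_subspaceD:
  assumes "closed_subspace scl W"
  shows "closed W" "0 \<in> W" "x \<in> W \<Longrightarrow> y \<in> W \<Longrightarrow> x + y \<in> W" "x \<in> W \<Longrightarrow> scl c x \<in> W"
    "x \<in> W \<Longrightarrow> y \<in> W \<Longrightarrow> x - y \<in> W" "x \<in> W \<Longrightarrow> r *\<^sub>R x \<in> W"
  using assms unfolding closed_subspace_def
  by (auto simp: subspace_0 subspace_add subspace_scale subspace_diff scaleR_eq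
      simp del: scale_of_real)

text \<open>Shifting y inside W by the component of \<open>x - y\<close> along z would shorten the
  distance by exactly that component, which therefore vanishes.\<close>

lemma minimizer_is_orthogonal:
  assumes W: "closed_subspace scl W" and y: "y \<in> W" "\<And>z. z \<in> W \<Longrightarrow> norm (x - y) \<le> norm (x - z)"
    and z: "z \<in> W"
  shows "ip (x - y) z = 0"
proof (cases "z = 0")
  case False
  let ?c = "ip (x - y) z / of_real ((norm z)\<^sup>2)"
  have "norm (x - y) \<le> norm (x - (y + scl ?c z))"
    by (intro y closed_subspaceD[OF W] z)
  then have "(norm (x - y))\<^sup>2 \<le> (norm (x - y - scl ?c z))\<^sup>2"
    by (simp add: diff_diff_eq)
  with norm_sq_remainder[OF False, of "x - y"] have "(norm (ip (x - y) z) / norm z)\<^sup>2 \<le> 0"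
    by linarith
  then show ?thesis using False by simp
qed simp

text \<open>A minimizing sequence is Cauchy by the parallelogram law, because midpoints stay in W
  and cannot be nearer to x than the infimum d.\<close>

lemma minimizer_exists:
  assumes W: "closed_subspace scl W"
  obtains y where "y \<in> W" "\<And>z. z \<in> W \<Longrightarrow> norm (x - y) \<le> norm (x - z)"
proof -
  have ne: "W \<noteq> {}" using closed_subspaceD(2)[OF W] by blast
  define d where "d = infdist x W"
  have d0: "d \<ge> 0" by (simp add: d_def infdist_nonneg)
  have dle: "d \<le> norm (x - z)" if "z \<in> W" for z
    using infdist_le[OF that, of x] by (simp add: d_def dist_norm)
  have "\<exists>z\<in>W. (norm (x - z))\<^sup>2 < d\<^sup>2 + e" if e: "e > 0" for e
  proof -
    have "d < sqrt (d\<^sup>2 + e)" using d0 e by (simp add: real_less_rsqrt)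
    then have "Inf (dist x ` W) < sqrt (d\<^sup>2 + e)"
      using ne by (simp add: d_def infdist_notempty)
    then obtain z where z: "z \<in> W" "dist x z < sqrt (d\<^sup>2 + e)"
      using cInf_lessD[of "dist x ` W"] ne by blast
    then have "(norm (x - z))\<^sup>2 < (sqrt (d\<^sup>2 + e))\<^sup>2"
      by (intro power_strict_mono) (auto simp: dist_norm)
    then show ?thesis using z e by auto
  qed
  then have "\<exists>z\<in>W. (norm (x - z))\<^sup>2 < d\<^sup>2 + 1 / real (Suc n)" for n by simp
  then obtain s where s: "s n \<in> W" "(norm (x - s n))\<^sup>2 < d\<^sup>2 + 1 / real (Suc n)" for n by metis
  \<comment> \<open>Parallelogram law for \<open>x - s m\<close> and \<open>x - s n\<close>: their
    sum is twice the vector from the midpoint to x, of squared norm at least four times the square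
    of d.\<close>
  have gap: "(norm (s m - s n))\<^sup>2 \<le> 2 / real (Suc m) + 2 / real (Suc n)" for m n
  proof -
    have "(1/2) *\<^sub>R (s m + s n) \<in> W" by (intro closed_subspaceD[OF W] s)
    then have "d\<^sup>2 \<le> (norm (x - (1/2) *\<^sub>R (s m + s n)))\<^sup>2"
      using dle d0 by (intro power_mono) auto
    moreover have "(norm ((x - s m) + (x - s n)))\<^sup>2 = 4 * (norm (x - (1/2) *\<^sub>R (s m + s n)))\<^sup>2"
    proof -
      have "(x - s m) + (x - s n) = 2 *\<^sub>R (x - (1/2) *\<^sub>R (s m + s n))"
        by (simp add: algebra_simps scaleR_2)
      then show ?thesis by (simp only: norm_scaleR power_mult_distrib) simp
    qed
    moreover have "(norm ((x - s m) + (x - s n)))\<^sup>2 + (norm (s m - s n))\<^sup>2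
        = 2 * (norm (x - s m))\<^sup>2 + 2 * (norm (x - s n))\<^sup>2"
      using parallelogram[of "x - s m" "x - s n"] by (simp add: norm_minus_commute)
    moreover have "2 / real (Suc k) = 2 * (1 / real (Suc k))" for k by simp
    ultimately show ?thesis
      using s(2)[of m] s(2)[of n] by linarith
  qed
  have "Cauchy s"
  proof (rule metric_CauchyI)
    fix e :: real assume e: "e > 0"
    \<comment> \<open>With this k each \<open>1 / Suc i\<close> beyond k is below a quarter of the
      square of e, so the two terms of \<open>gap\<close> together stay below that square.\<close>
    obtain k :: nat where k: "4 / e\<^sup>2 < real k" using reals_Archimedean2 by blast
    have "dist (s m) (s n) < e" if "m \<ge> k" "n \<ge> k" for m n
    proof -
      have "1 / real (Suc i) < e\<^sup>2 / 4" if "i \<ge> k" for i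
      proof -
        have "4 / e\<^sup>2 < real (Suc i)" using k that by linarith
        then show ?thesis using e by (simp add: field_simps)
      qed
      from this[OF that(1)] this[OF that(2)] have "(norm (s m - s n))\<^sup>2 < e\<^sup>2"
        using gap[of m n] by simp
      then show ?thesis using e by (simp add: dist_norm power2_less_imp_less)
    qed
    then show "\<exists>M. \<forall>m\<ge>M. \<forall>n\<ge>M. dist (s m) (s n) < e" by blast
  qed
  then obtain y where y: "s \<longlonglongrightarrow> y" using Cauchy_convergent convergent_def by blast
  have "y \<in> W" using closed_sequentially[OF closed_subspaceD(1)[OF W]] s(1) y by blast
  moreover have "(norm (x - y))\<^sup>2 \<le> d\<^sup>2"
  proof (rule LIMSEQ_le)
    show "(\<lambda>n. (norm (x - s n))\<^sup>2) \<longlonglongrightarrow> (norm (x - y))\<^sup>2" by (intro tendsto_intros y)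
    show "(\<lambda>n. d\<^sup>2 + 1 / real (Suc n)) \<longlonglongrightarrow> d\<^sup>2"
      using tendsto_add[OF tendsto_const[of "d\<^sup>2"] LIMSEQ_inverse_real_of_nat]
      by (simp add: divide_inverse)
  qed (auto intro!: exI[of _ 0] less_imp_le s(2) simp del: of_nat_Suc)
  then have "norm (x - y) \<le> d" using d0 by (rule power2_le_imp_le)
  then have "norm (x - y) \<le> norm (x - z)" if "z \<in> W" for z using dle[OF that] by linarith
  ultimately show ?thesis using that by blast
qed

text \<open>Two candidates differ by a vector of W that is orthogonal to itself. This is how the
  definite description gets evaluated.\<close>

lemma orth_proj_unique:
  assumes W: "closed_subspace scl W" and "y \<in> W" "\<And>z. z \<in> W \<Longrightarrow> ip (x - y) z = 0"
  shows "orth_proj ip W x = y"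
  unfolding orth_proj_def
proof (rule the_equality)
  fix y' assume y': "y' \<in> W \<and> (\<forall>z\<in>W. ip (x - y') z = 0)"
  have "y - y' \<in> W" using assms(2) y' by (blast intro: closed_subspaceD[OF W])
  then have "ip (x - y') (y - y') - ip (x - y) (y - y') = 0" using assms(3) y' by simp
  then have "ip (y - y') (y - y') = 0" by (simp add: ip_diff_left)
  then show "y' = y" using ip_self_eq_0 by force
qed (use assms in auto)

lemma orth_proj:
  assumes W: "closed_subspace scl W"
  shows orth_proj_mem: "orth_proj ip W x \<in> W"
    and orth_proj_orthogonal: "z \<in> W \<Longrightarrow> ip (x - orth_proj ip W x) z = 0"
proof -
  obtain y where "y \<in> W" "\<And>z. z \<in> W \<Longrightarrow> norm (x - y) \<le> norm (x - z)"
    using minimizer_exists[OF W] by blast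
  then have "y \<in> W \<and> (\<forall>z\<in>W. ip (x - y) z = 0)"
    using minimizer_is_orthogonal[OF W] by blast
  then have "orth_proj ip W x \<in> W \<and> (\<forall>z\<in>W. ip (x - orth_proj ip W x) z = 0)"
    using orth_proj_unique[OF W] by metis
  then show "orth_proj ip W x \<in> W" "z \<in> W \<Longrightarrow> ip (x - orth_proj ip W x) z = 0" by blast+
qed

lemma orth_proj_ident: "closed_subspace scl W \<Longrightarrow> x \<in> W \<Longrightarrow> orth_proj ip W x = x"
  by (rule orth_proj_unique) simp_all

lemma ip_orth_proj_left:
  assumes "closed_subspace scl W" "z \<in> W"
  shows "ip (orth_proj ip W x) z = ip x z"
  using orth_proj_orthogonal[OF assms, of x] by (simp add: ip_diff_left)

lemma ip_orth_proj_right: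
  assumes "closed_subspace scl W" "z \<in> W"
  shows "ip z (orth_proj ip W x) = ip z x"
  by (metis assms ip_commute ip_orth_proj_left)

lemma ip_orth_proj:
  assumes "closed_subspace scl W"
  shows "ip (orth_proj ip W x) y = ip x (orth_proj ip W y)"
  using ip_orth_proj_left[OF assms orth_proj_mem[OF assms], of x y]
    ip_orth_proj_right[OF assms orth_proj_mem[OF assms], of x y] by simp

lemma orth_proj_add:
  assumes "closed_subspace scl W"
  shows "orth_proj ip W (x + y) = orth_proj ip W x + orth_proj ip W y"
  by (rule ip_eqI) (simp add: ip_orth_proj[OF assms] ip_add_left)

lemma orth_proj_scale:
  assumes "closed_subspace scl W"
  shows "orth_proj ip W (scl c x) = scl c (orth_proj ip W x)"
  by (rule ip_eqI) (simp add: ip_orth_proj[OF assms] ip_scale_left)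

lemma norm_orth_proj_le:
  assumes "closed_subspace scl W"
  shows "norm (orth_proj ip W x) \<le> norm x"
proof -
  have "(norm (orth_proj ip W x + (x - orth_proj ip W x)))\<^sup>2
      = (norm (orth_proj ip W x))\<^sup>2 + (norm (x - orth_proj ip W x))\<^sup>2"
    by (rule Pythagoras)
      (simp add: ip_eq_0_commute[of "orth_proj ip W x"] orth_proj_orthogonal orth_proj_mem assms)
  then have "(norm (orth_proj ip W x))\<^sup>2 \<le> (norm x)\<^sup>2" by simp
  then show ?thesis by (rule power2_le_imp_le) simp
qed

lemma bounded_op_orth_proj:
  assumes "closed_subspace scl W"
  shows "bounded_op scl scl (orth_proj ip W)"
  unfolding bounded_op_def
proof
  show "Vector_Spaces.linear scl scl (orth_proj ip W)"
    by unfold_locales (simp_all add: orth_proj_add orth_proj_scale assms)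
  show "\<exists>C. \<forall>x. norm (orth_proj ip W x) \<le> C * norm x"
    by (rule exI[of _ 1]) (simp add: norm_orth_proj_le assms)
qed

subsection \<open>The Riesz representation theorem and adjoints\<close>

text \<open>The kernel of \<open>\<psi>\<close> is closed, and a vector z orthogonal to it with
  \<open>\<psi> z\<close> nonzero spans its complement. Up to a conjugated factor z is the
  representing vector.\<close>

lemma Riesz_representation:
  assumes add: "\<And>x y. \<psi> (x + y) = \<psi> x + \<psi> y"
    and scale: "\<And>c x. \<psi> (scl c x) = c * \<psi> x"
    and bound: "\<And>x. norm (\<psi> x) \<le> C * norm x"
  obtains y where "\<And>x. \<psi> x = ip x y"
proof (cases "\<forall>x. \<psi> x = 0")
  case True
  then show ?thesis using that[of 0] by simp
next
  case False
  then obtain x0 where x0: "\<psi> x0 \<noteq> 0" by blast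
  have bl: "bounded_linear \<psi>"
    by (rule bounded_linear_intro[where K = C])
      (simp_all add: add scaleR_eq scale scaleR_conv_of_real mult.commute bound del: scale_of_real)
  define W where "W = {x. \<psi> x = 0}"
  have "closed W"
    unfolding W_def by (intro closed_Collect_eq continuous_intros linear_continuous_on bl)
  then have W: "closed_subspace scl W"
    by (auto simp: closed_subspace_def subspace_def W_def add scale linear_simps[OF bl])
  define z where "z = x0 - orth_proj ip W x0"
  have "\<psi> z = \<psi> x0"
    using orth_proj_mem[OF W, of x0] by (simp add: z_def linear_simps[OF bl] W_def)
  with x0 have \<psi>z: "\<psi> z \<noteq> 0" by simp
  then have z0: "z \<noteq> 0" by (auto simp: linear_simps[OF bl])
  have "\<psi> x = ip x (scl (conjg (\<psi> z) / of_real ((norm z)\<^sup>2)) z)" for x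
  proof -
    \<comment> \<open>This combination is annihilated by \<open>\<psi>\<close>, so it is orthogonal
      to z; solving that equation for \<open>\<psi> x\<close> gives the formula.\<close>
    have "scl (\<psi> z) x - scl (\<psi> x) z \<in> W" by (simp add: W_def linear_simps[OF bl] scale)
    then have "ip z (scl (\<psi> z) x - scl (\<psi> x) z) = 0"
      using orth_proj_orthogonal[OF W] by (simp add: z_def)
    then have "ip (scl (\<psi> z) x - scl (\<psi> x) z) z = 0" by (simp add: ip_eq_0_commute)
    then have eq: "\<psi> z * ip x z = \<psi> x * of_real ((norm z)\<^sup>2)"
      by (simp add: ip_diff_left ip_scale_left ip_self)
    have conjg_coeff: "conjg (conjg (\<psi> z) / of_real ((norm z)\<^sup>2)) = \<psi> z / of_real ((norm z)\<^sup>2)"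
      by (simp only: divide_inverse of_real_inverse[symmetric] conjg_mult conjg_of_real conjg_conjg)
    have "ip x (scl (conjg (\<psi> z) / of_real ((norm z)\<^sup>2)) z)
        = \<psi> x * of_real ((norm z)\<^sup>2) / of_real ((norm z)\<^sup>2)"
      by (simp only: ip_scale_right conjg_coeff times_divide_eq_left eq)
    then show ?thesis using z0 by simp
  qed
  then show ?thesis using that by blast
qed

end

lemma bounded_op_simps:
  assumes "bounded_op s1 s2 L"
  shows "L (x + y) = L x + L y" "L (s1 c x) = s2 c (L x)"
proof -
  have "Vector_Spaces.linear s1 s2 L" using assms by (simp add: bounded_op_def)
  then interpret Vector_Spaces.linear s1 s2 L .
  show "L (x + y) = L x + L y" "L (s1 c x) = s2 c (L x)" by (rule add scale)+
qed

text \<open>Forgetting all but the real scalars opens the calculus of real bounded linear maps: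
  continuity, limits, \<open>linear_simps\<close>.\<close>

lemma bounded_op_bounded_linear:
  assumes "hilbert_space s1 ip1" "hilbert_space s2 ip2" "bounded_op s1 s2 L"
  shows "bounded_linear L"
proof -
  interpret H1: hilbert_space s1 ip1 by fact
  interpret H2: hilbert_space s2 ip2 by fact
  obtain C where C: "\<And>x. norm (L x) \<le> C * norm x"
    using assms(3) unfolding bounded_op_def by blast
  show ?thesis
  proof (rule bounded_linear_intro[where K = C])
    show "L (r *\<^sub>R x) = r *\<^sub>R L x" for r x
      using bounded_op_simps(2)[OF assms(3), of "of_real r" x]
      by (simp add: H1.scale_of_real H2.scale_of_real)
  qed (simp_all add: bounded_op_simps[OF assms(3)] C mult.commute)
qed

lemma bounded_op_compose:
  assumes "hilbert_space s1 ip1" "hilbert_space s2 ip2" "hilbert_space s3 ip3"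
    and "bounded_op s1 s2 L" "bounded_op s2 s3 L'"
  shows "bounded_op s1 s3 (\<lambda>x. L' (L x))"
  unfolding bounded_op_def
proof
  interpret H1: hilbert_space s1 ip1 by fact
  interpret H3: hilbert_space s3 ip3 by fact
  show "Vector_Spaces.linear s1 s3 (\<lambda>x. L' (L x))"
    by unfold_locales (simp_all add: bounded_op_simps[OF assms(4)] bounded_op_simps[OF assms(5)])
  have "bounded_linear (\<lambda>x. L' (L x))"
    using assms by (intro bounded_linear_compose[of L' L] bounded_op_bounded_linear)
  then show "\<exists>C. \<forall>x. norm (L' (L x)) \<le> C * norm x"
    using bounded_linear.bounded by (metis mult.commute)
qed

text \<open>Riesz, applied for each y to the functional sending x to \<open>ip2 (L x) y\<close>,
  gives existence; nondegeneracy of \<open>ip1\<close> gives the uniqueness that the description in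
  \<open>adj\<close> asks for.\<close>

lemma ip_adj:
  assumes "hilbert_space s1 ip1" "hilbert_space s2 ip2" "bounded_op s1 s2 L"
  shows "ip1 x (adj ip1 ip2 L y) = ip2 (L x) y"
proof -
  interpret H1: hilbert_space s1 ip1 by fact
  interpret H2: hilbert_space s2 ip2 by fact
  obtain C where C: "\<And>x. norm (L x) \<le> norm x * C"
    using bounded_linear.bounded[OF bounded_op_bounded_linear[OF assms]] by blast
  have "\<exists>z. \<forall>x. ip2 (L x) y = ip1 x z" for y
  proof -
    have "norm (ip2 (L x) y) \<le> C * norm y * norm x" for x
      using H2.Cauchy_Schwarz[of "L x" y] mult_right_mono[OF C[of x], of "norm y"]
      by (simp add: mult_ac)
    then obtain z where "\<And>x. ip2 (L x) y = ip1 x z"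
      using H1.Riesz_representation[of "\<lambda>x. ip2 (L x) y" "C * norm y"]
      by (auto simp: bounded_op_simps[OF assms(3)] H2.ip_add_left H2.ip_scale_left)
    then show ?thesis by blast
  qed
  then obtain L' where L': "\<And>x y. ip2 (L x) y = ip1 x (L' y)" by metis
  have "adj ip1 ip2 L = L'"
    unfolding adj_def
  proof (rule the_equality)
    fix L'' assume "\<forall>x y. ip2 (L x) y = ip1 x (L'' y)"
    then have "ip1 x (L'' y) = ip1 x (L' y)" for x y using L' by metis
    then have "ip1 (L'' y) x = ip1 (L' y) x" for x y by (metis H1.ip_commute)
    then show "L'' = L'" using H1.ip_eqI by blast
  qed (use L' in blast)
  then show ?thesis by (simp add: L')
qed

lemma ip_adj_left:
  assumes "hilbert_space s1 ip1" "hilbert_space s2 ip2" "bounded_op s1 s2 L"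
  shows "ip1 (adj ip1 ip2 L y) x = ip2 y (L x)"
  unfolding hilbert_space.ip_commute[OF assms(1), of "adj ip1 ip2 L y" x] ip_adj[OF assms]
  by (rule hilbert_space.ip_commute[OF assms(2), symmetric])

subsection \<open>Positive definite operators\<close>

text \<open>The field \<open>'k\<close> has no order, so positivity is phrased as coercivity of
  \<open>norm (ip (S x) x)\<close>. The locale is used twice: for the discrete frame operator on the
  relay space and for the new relay frame operator on \<open>'h\<close>.\<close>

locale positive_definite_op = hilbert_space scl ip
  for scl :: "'k::real_or_complex \<Rightarrow> 'a::banach \<Rightarrow> 'a" and ip :: "'a \<Rightarrow> 'a \<Rightarrow> 'k" +
  fixes S :: "'a \<Rightarrow> 'a" and A :: real
  assumes bounded: "bounded_op scl scl S"
    and self_adjoint: "ip (S x) y = ip x (S y)"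
    and pos: "0 < A"
    and lower: "A * (norm x)\<^sup>2 \<le> norm (ip (S x) x)"
begin

lemma bounded_linear: "bounded_linear S"
  using bounded_op_bounded_linear[OF hilbert_space_axioms hilbert_space_axioms bounded] .

lemma norm_ge: "A * norm x \<le> norm (S x)"
proof (cases "x = 0")
  case False
  have "A * (norm x)\<^sup>2 \<le> norm (S x) * norm x"
    using lower[of x] Cauchy_Schwarz[of "S x" x] by linarith
  then show ?thesis using False by (simp add: power2_eq_square)
qed simp

lemma inj: "inj S"
proof (rule injI)
  fix x y assume "S x = S y"
  then have "S (x - y) = 0" by (simp add: linear_simps[OF bounded_linear])
  then have "A * norm (x - y) \<le> 0" using norm_ge[of "x - y"] by simp
  then show "x = y" using pos by (simp add: mult_le_0_iff)
qed

text \<open>A bounded linear map that is bounded below carries complete subspaces to complete ones.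
  Applied to the whole space it makes the range closed.\<close>

lemma closed_subspace_image:
  assumes "closed_subspace scl W"
  shows "closed_subspace scl (S ` W)"
  unfolding closed_subspace_def
proof
  have "subspace W" using assms by (auto simp: closed_subspace_def)
  then show "subspace (S ` W)"
    by (intro subspaceI)
      (auto simp: subspace_0 subspace_add subspace_scale bounded_op_simps[OF bounded, symmetric]
        intro!: image_eqI[of 0 S 0] linear_simps(3)[OF bounded_linear, symmetric])
  have "real_vector.subspace W"
    by (simp add: real_vector.subspace_def closed_subspaceD[OF assms])
  moreover have "complete W"
    using closed_subspaceD(1)[OF assms] by (simp add: complete_eq_closed)
  ultimately have "complete (S ` W)"
    using complete_isometric_image[OF pos _ bounded_linear] norm_ge by blast
  then show "closed (S ` W)" by (simp add: complete_eq_closed)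
qed

text \<open>The range is closed, and a vector orthogonal to it vanishes by positivity.\<close>

lemma surj: "surj S"
proof -
  have "closed_subspace scl UNIV" by (simp add: closed_subspace_def)
  note range = closed_subspace_image[OF this]
  have "y \<in> range S" for y
  proof -
    define z where "z = y - orth_proj ip (range S) y"
    have "ip z (S z) = 0" using orth_proj_orthogonal[OF range, of "S z" y] by (simp add: z_def)
    then have "A * (norm z)\<^sup>2 \<le> 0" using lower[of z] by (simp add: self_adjoint)
    then have "z = 0" using pos by (simp add: mult_le_0_iff)
    then show ?thesis using orth_proj_mem[OF range, of y] by (simp add: z_def)
  qed
  then show ?thesis by blast
qed

lemma bij: "bij S"
  using inj surj by (simp add: bij_def)

lemma inv_cancel [simp]: "S (inv S x) = x" "inv S (S x) = x"
  using surj inj by (simp_all add: surj_f_inv_f)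

lemma inv_self_adjoint: "ip (inv S x) y = ip x (inv S y)"
  using self_adjoint[of "inv S x" "inv S y"] by simp

lemma norm_inv_le: "norm (inv S x) \<le> (1 / A) * norm x"
  using norm_ge[of "inv S x"] pos by (simp add: field_simps)

text \<open>Boundedness of S, read at \<open>inv S x\<close>. The constant enters the lower frame
  bound and the contraction rate of the iteration for projections.\<close>

lemma norm_inv_ge:
  obtains m where "0 < m" "\<And>x. m * norm x \<le> norm (inv S x)"
proof -
  obtain C where C: "0 < C" "\<And>x. norm (S x) \<le> norm x * C"
    using bounded_linear.pos_bounded[OF bounded_linear] by blast
  have "1 / C * norm x \<le> norm (inv S x)" for x
    using C(2)[of "inv S x"] C(1) by (simp add: field_simps)
  then show ?thesis using C(1) that[of "1 / C"] by simp
qed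

lemma bounded_inv: "bounded_op scl scl (inv S)"
  unfolding bounded_op_def
proof
  have "inv S (x + y) = inv S x + inv S y" for x y
    by (rule injD[OF inj]) (simp add: bounded_op_simps[OF bounded])
  moreover have "inv S (scl c x) = scl c (inv S x)" for c x
    by (rule injD[OF inj]) (simp add: bounded_op_simps[OF bounded])
  ultimately show "Vector_Spaces.linear scl scl (inv S)"
    by unfold_locales
  show "\<exists>C. \<forall>x. norm (inv S x) \<le> C * norm x" using norm_inv_le by blast
qed

lemma bounded_linear_inv: "bounded_linear (inv S)"
  using bounded_op_bounded_linear[OF hilbert_space_axioms hilbert_space_axioms bounded_inv] .

text \<open>By bijectivity this image is the preimage of W under the continuous map S.\<close>

lemma closed_subspace_inv_image:
  assumes W: "closed_subspace scl W"
  shows "closed_subspace scl (inv S ` W)"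
proof -
  have eq: "inv S ` W = S -` W"
    using bij by (simp add: bij_vimage_eq_inv_image)
  have "closed (S -` W)"
    by (intro closed_vimage closed_subspaceD(1)[OF W] linear_continuous_on bounded_linear)
  moreover have "subspace (S -` W)"
    by (intro subspaceI)
      (auto simp: bounded_op_simps[OF bounded] linear_simps(3)[OF bounded_linear]
        closed_subspaceD[OF W])
  ultimately show ?thesis by (simp add: closed_subspace_def eq)
qed

end

subsection \<open>The frame operator of a discrete frame\<close>

text \<open>The work lies in the unconditional convergence of the defining series. After that,
  self-adjointness and coercivity are read off termwise from the scalar series for
  \<open>ip (?S x) y\<close>.\<close>

lemma (in hilbert_space) positive_definite_frame_operator:
  fixes I :: "'i set" and \<phi> :: "'i \<Rightarrow> 'a"
  assumes "hilbert_frame ip I \<phi>"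
  obtains A where "positive_definite_op scl ip (frame_operator scl ip I \<phi>) A"
proof -
  let ?S = "frame_operator scl ip I \<phi>"
  obtain A B where A: "0 < A" "A \<le> B"
    and summable: "\<And>x. (\<lambda>i. (norm (ip x (\<phi> i)))\<^sup>2) summable_on I"
    and lo: "\<And>x. A * (norm x)\<^sup>2 \<le> (\<Sum>\<^sub>\<infinity>i\<in>I. (norm (ip x (\<phi> i)))\<^sup>2)"
    and up: "\<And>x. (\<Sum>\<^sub>\<infinity>i\<in>I. (norm (ip x (\<phi> i)))\<^sup>2) \<le> B * (norm x)\<^sup>2"
    using assms unfolding hilbert_frame_def by blast
  have Bessel: "(\<Sum>i\<in>F. (norm (ip x (\<phi> i)))\<^sup>2) \<le> B * (norm x)\<^sup>2" if "finite F" "F \<subseteq> I" for F x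
    using finite_sum_le_infsum[OF summable[of x] that] up[of x] by simp
  \<comment> \<open>The dual of the Bessel inequality: pair the finite sum y with itself, apply
    Cauchy-Schwarz to the coefficients, bound \<open>ip y (\<phi> i)\<close> by Bessel, and cancel
    the square of \<open>norm y\<close>.\<close>
  have synthesis: "(norm (\<Sum>i\<in>F. scl (c i) (\<phi> i)))\<^sup>2 \<le> B * (\<Sum>i\<in>F. (norm (c i))\<^sup>2)"
    if F: "finite F" "F \<subseteq> I" for c :: "'i \<Rightarrow> 'k" and F
  proof (cases "(\<Sum>i\<in>F. scl (c i) (\<phi> i)) = 0")
    case True
    then show ?thesis using A by (simp add: sum_nonneg)
  next
    case False
    define y where "y = (\<Sum>i\<in>F. scl (c i) (\<phi> i))"
    have "norm (ip (\<phi> i) y) = norm (ip y (\<phi> i))" for i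
      by (metis ip_commute norm_conjg)
    moreover have "ip y y = (\<Sum>i\<in>F. c i * ip (\<phi> i) y)"
      by (subst (1) y_def) (simp add: ip_sum_left ip_scale_left)
    ultimately have "(norm y)\<^sup>2 \<le> (\<Sum>i\<in>F. norm (c i) * norm (ip y (\<phi> i)))"
      using norm_sum[of "\<lambda>i. c i * ip (\<phi> i) y" F] norm_ip_self[of y] by (simp add: norm_mult)
    then have "((norm y)\<^sup>2)\<^sup>2 \<le> (\<Sum>i\<in>F. norm (c i) * norm (ip y (\<phi> i)))\<^sup>2"
      by (intro power_mono) auto
    also have "\<dots> \<le> (\<Sum>i\<in>F. (norm (c i))\<^sup>2) * (\<Sum>i\<in>F. (norm (ip y (\<phi> i)))\<^sup>2)"
      by (rule Cauchy_Schwarz_ineq_sum)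
    also have "\<dots> \<le> (\<Sum>i\<in>F. (norm (c i))\<^sup>2) * (B * (norm y)\<^sup>2)"
      by (intro mult_left_mono Bessel[OF F] sum_nonneg) auto
    finally have "(norm y)\<^sup>2 * (norm y)\<^sup>2 \<le> (B * (\<Sum>i\<in>F. (norm (c i))\<^sup>2)) * (norm y)\<^sup>2"
      by (simp add: power2_eq_square[of "(norm y)\<^sup>2"] mult_ac)
    moreover have "0 < (norm y)\<^sup>2" using False by (simp add: y_def)
    ultimately have "(norm y)\<^sup>2 \<le> B * (\<Sum>i\<in>F. (norm (c i))\<^sup>2)" by (rule mult_right_le_imp_le)
    then show ?thesis by (simp only: y_def)
  qed
  have "(\<lambda>i. scl (ip x (\<phi> i)) (\<phi> i)) summable_on I" for x
  proof -
    let ?f = "\<lambda>i. scl (ip x (\<phi> i)) (\<phi> i)" and ?g = "\<lambda>i. (norm (ip x (\<phi> i)))\<^sup>2"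
    \<comment> \<open>Cauchy criterion along finite subsets of an arbitrary index set. Beyond a
      finite F0 the coefficients have small square sum, and \<open>synthesis\<close> turns this into
      small vector sums.\<close>
    have "\<exists>P. eventually P (finite_subsets_at_top I) \<and> (\<forall>F F'. P F \<and> P F' \<longrightarrow> dist (sum ?f F) (sum ?f F') < e)"
      if e: "e > 0" for e
    proof -
      \<comment> \<open>Chosen so that B times d is the square of \<open>e / 2\<close>, each partial
        sum then being within \<open>e / 2\<close> of the one over F0.\<close>
      define d where "d = e\<^sup>2 / (4 * B)"
      have d: "d > 0" "B * d = (e / 2)\<^sup>2" using e A by (auto simp: d_def power2_eq_square)
      have "eventually (\<lambda>F. dist (sum ?g F) (infsum ?g I) < d) (finite_subsets_at_top I)"
        using has_sum_infsum[OF summable[of x]] d unfolding has_sum_def tendsto_iff by blast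
      then obtain F0 where F0: "finite F0" "F0 \<subseteq> I"
        and F0': "\<And>F. finite F \<Longrightarrow> F0 \<subseteq> F \<Longrightarrow> F \<subseteq> I \<Longrightarrow> dist (sum ?g F) (infsum ?g I) < d"
        unfolding eventually_finite_subsets_at_top by metis
      have close: "norm (sum ?f F - sum ?f F0) < e / 2" if F: "finite F" "F0 \<subseteq> F" "F \<subseteq> I" for F
      proof -
        have "(norm (sum ?f (F - F0)))\<^sup>2 \<le> B * sum ?g (F - F0)"
          using F by (intro synthesis) auto
        also have "sum ?g (F - F0) = sum ?g F - sum ?g F0" using F by (simp add: sum_diff F0)
        also have "\<dots> < d"
          using F0'[OF F0(1) order_refl F0(2)] finite_sum_le_infsum[OF summable[of x] F(1,3)]
          by (auto simp: dist_real_def)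
        finally have "(norm (sum ?f (F - F0)))\<^sup>2 < (e / 2)\<^sup>2" using A by (simp add: d)
        then have "norm (sum ?f (F - F0)) < e / 2" by (rule power2_less_imp_less) (use e in simp)
        then show ?thesis using F F0 by (simp add: sum_diff)
      qed
      let ?P = "\<lambda>F. finite F \<and> F0 \<subseteq> F \<and> F \<subseteq> I"
      have ev: "eventually ?P (finite_subsets_at_top I)"
        unfolding eventually_finite_subsets_at_top using F0 by blast
      have cl: "dist (sum ?f F) (sum ?f F') < e" if "?P F" "?P F'" for F F'
        using close[of F] close[of F'] that norm_triangle_ineq4[of "sum ?f F - sum ?f F0" "sum ?f F' - sum ?f F0"]
        by (simp add: dist_norm)
      show ?thesis
        by (intro exI[of _ ?P] conjI allI impI ev) (elim conjE, intro cl conjI; assumption)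
    qed
    then have "cauchy_filter (filtermap (sum ?f) (finite_subsets_at_top I))"
      by (simp add: cauchy_filter_metric_filtermap)
    moreover have "complete (UNIV :: 'a set)"
      by (simp add: complete_eq_closed)
    ultimately obtain y where "filtermap (sum ?f) (finite_subsets_at_top I) \<le> nhds y"
      using cauchy_filter_complete_converges[of "filtermap (sum ?f) (finite_subsets_at_top I)" UNIV]
      by (auto simp: filtermap_bot_iff)
    then show ?thesis
      by (auto simp: summable_on_def has_sum_def filterlim_def)
  qed
  then have S: "((\<lambda>i. scl (ip x (\<phi> i)) (\<phi> i)) has_sum ?S x) I" for x
    unfolding frame_operator_def by simp
  have ipS: "((\<lambda>i. ip x (\<phi> i) * ip (\<phi> i) y) has_sum ip (?S x) y) I" for x y
    using has_sum_bounded_linear[OF bounded_linear_ip_left[of y] S[of x]] by (simp add: ip_scale_left)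
  have "positive_definite_op scl ip ?S A"
  proof unfold_locales
    show "bounded_op scl scl ?S"
      unfolding bounded_op_def
    proof (intro conjI exI allI)
      show "Vector_Spaces.linear scl scl ?S"
      proof unfold_locales
        fix x y c
        show "?S (x + y) = ?S x + ?S y"
          using has_sum_add[OF S[of x] S[of y]]
          by (simp add: frame_operator_def[of scl ip I \<phi> "x + y"] ip_add_left scale_left_distrib infsumI)
        show "?S (scl c x) = scl c (?S x)"
          using has_sum_bounded_linear[OF bounded_linear_scl[of c] S[of x]]
          by (simp add: frame_operator_def[of scl ip I \<phi> "scl c x"] ip_scale_left infsumI)
      qed
      fix x
      have lim: "(sum (\<lambda>i. scl (ip x (\<phi> i)) (\<phi> i)) \<longlongrightarrow> ?S x) (finite_subsets_at_top I)"
        using S[of x] by (simp add: has_sum_def)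
      \<comment> \<open>One factor B comes from \<open>synthesis\<close>, the other from
        \<open>Bessel\<close>; the estimate passes to the limit over finite subsets.\<close>
      have "(norm (?S x))\<^sup>2 \<le> B * (B * (norm x)\<^sup>2)"
      proof (rule tendsto_upperbound)
        show "((\<lambda>F. (norm (\<Sum>i\<in>F. scl (ip x (\<phi> i)) (\<phi> i)))\<^sup>2) \<longlongrightarrow> (norm (?S x))\<^sup>2) (finite_subsets_at_top I)"
          by (intro tendsto_intros lim)
        show "\<forall>\<^sub>F F in finite_subsets_at_top I. (norm (\<Sum>i\<in>F. scl (ip x (\<phi> i)) (\<phi> i)))\<^sup>2 \<le> B * (B * (norm x)\<^sup>2)"
        proof (rule eventually_finite_subsets_at_top_weakI)
          fix F assume F: "finite F" "F \<subseteq> I"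
          have "B * (\<Sum>i\<in>F. (norm (ip x (\<phi> i)))\<^sup>2) \<le> B * (B * (norm x)\<^sup>2)"
            using A by (intro mult_left_mono Bessel[OF F]) auto
          then show "(norm (\<Sum>i\<in>F. scl (ip x (\<phi> i)) (\<phi> i)))\<^sup>2 \<le> B * (B * (norm x)\<^sup>2)"
            by (rule order_trans[OF synthesis[OF F]])
        qed
      qed simp
      then have "(norm (?S x))\<^sup>2 \<le> (B * norm x)\<^sup>2" by (simp add: power2_eq_square mult_ac)
      then show "norm (?S x) \<le> B * norm x" by (rule power2_le_imp_le) (use A in auto)
    qed
  next
    fix x y
    have "((\<lambda>i. conjg (ip y (\<phi> i) * ip (\<phi> i) x)) has_sum conjg (ip (?S y) x)) I"
      by (rule has_sum_bounded_linear[OF bounded_linear_conjg ipS[of y x]])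
    moreover have "conjg (ip y (\<phi> i) * ip (\<phi> i) x) = ip x (\<phi> i) * ip (\<phi> i) y" for i
      by (metis conjg_mult ip_commute mult.commute)
    ultimately have "((\<lambda>i. ip x (\<phi> i) * ip (\<phi> i) y) has_sum ip x (?S y)) I"
      by (simp add: ip_commute[of "?S y" x] conjg_conjg)
    then show "ip (?S x) y = ip x (?S y)"
      using ipS has_sum_unique by blast
  next
    fix x
    have "((\<lambda>i. (of_real ((norm (ip x (\<phi> i)))\<^sup>2) :: 'k)) has_sum of_real (\<Sum>\<^sub>\<infinity>i\<in>I. (norm (ip x (\<phi> i)))\<^sup>2)) I"
      by (rule has_sum_bounded_linear[OF bounded_linear_of_real has_sum_infsum[OF summable]])
    moreover have "of_real ((norm (ip x (\<phi> i)))\<^sup>2) = ip x (\<phi> i) * ip (\<phi> i) x" for i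
      by (metis ip_commute mult_conjg_of_real)
    ultimately have "ip (?S x) x = of_real (\<Sum>\<^sub>\<infinity>i\<in>I. (norm (ip x (\<phi> i)))\<^sup>2)"
      by (intro has_sum_unique[OF ipS[of x x]]) (simp del: of_real_power)
    then show "A * (norm x)\<^sup>2 \<le> norm (ip (?S x) x)" using lo[of x] by simp
  qed (rule A)
  then show ?thesis by (rule that)
qed

subsection \<open>Strong measurability\<close>

text \<open>The simple approximants take countably many values in all. With
  \<open>strongly_measurableI\<close> this yields the Pettis form of strong measurability: Borel
  measurable with separable range.\<close>

lemma strongly_measurable_separable_range:
  assumes "strongly_measurable M f"
  shows "\<exists>D. countable D \<and> f ` space M \<subseteq> closure D"
proof -
  obtain s where s: "\<And>n::nat. simple_function M (s n)" "\<And>x. x \<in> space M \<Longrightarrow> (\<lambda>n. s n x) \<longlonglongrightarrow> f x"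
    using assms unfolding strongly_measurable_def by blast
  have "countable (\<Union>n. s n ` space M)"
    using simple_functionD(1)[OF s(1)] by (intro countable_UN) (auto intro: countable_finite)
  moreover have "f ` space M \<subseteq> closure (\<Union>n. s n ` space M)"
  proof
    fix y assume "y \<in> f ` space M"
    then obtain x where x: "x \<in> space M" "y = f x" by blast
    then show "y \<in> closure (\<Union>n. s n ` space M)"
      unfolding closure_sequential using s(2)[OF x(1)] by (intro exI[of _ "\<lambda>n. s n x"]) auto
  qed
  ultimately show ?thesis by blast
qed

lemma strongly_measurable_borel:
  assumes "strongly_measurable M f"
  shows "f \<in> borel_measurable M"
proof -
  obtain s where s: "\<And>n::nat. simple_function M (s n)" "\<And>x. x \<in> space M \<Longrightarrow> (\<lambda>n. s n x) \<longlonglongrightarrow> f x"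
    using assms unfolding strongly_measurable_def by blast
  show ?thesis
    by (rule borel_measurable_LIMSEQ_metric[OF _ s(2)]) (rule borel_measurable_simple_function[OF s(1)])
qed

lemma borel_measurable_dist_const:
  assumes "f \<in> borel_measurable M"
  shows "(\<lambda>x. dist (f x) d) \<in> borel_measurable M"
  by (rule borel_measurable_continuous_on[OF _ assms]) (intro continuous_intros)

text \<open>
  A pointwise approximation takes for the n-th value the first of those among n points of the dense
  sequence that are nearest to \<open>f x\<close>.
\<close>

lemma strongly_measurableI:
  fixes f :: "'w \<Rightarrow> 'a::metric_space"
  assumes "countable D" "f ` space M \<subseteq> closure D"
    and meas: "\<And>d. (\<lambda>x. dist (f x) d) \<in> borel_measurable M"
  shows "strongly_measurable M f"
proof (cases "D = {}")
  case True
  then have "space M = {}" using assms(2) by auto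
  then show ?thesis
    unfolding strongly_measurable_def by (intro exI[of _ "\<lambda>n x. undefined"]) auto
next
  case False
  define e where "e = from_nat_into D"
  have e: "range e = D" unfolding e_def by (rule range_from_nat_into[OF False assms(1)])
  \<comment> \<open>The bound by n keeps the index finite-valued, and taking the least such index
    below settles ties measurably.\<close>
  define P where "P n i x \<longleftrightarrow> i \<le> n \<and> (\<forall>j\<in>{..n}. dist (f x) (e i) \<le> dist (f x) (e j))" for n i :: nat and x
  define k where "k n x = (LEAST i. P n i x)" for n x
  have P: "P n (k n x) x" for n x
  proof -
    obtain i where "i \<in> {..n}" "\<And>j. j \<in> {..n} \<Longrightarrow> dist (f x) (e i) \<le> dist (f x) (e j)"
      using ex_is_arg_min_if_finite[of "{..n}" "\<lambda>i. dist (f x) (e i)"]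
      by (auto simp: is_arg_min_linorder)
    then have "P n i x" by (auto simp: P_def)
    then show ?thesis unfolding k_def by (rule LeastI)
  qed
  have "simple_function M (k n)" for n
    unfolding simple_function_eq_measurable
  proof
    have "k n ` space M \<subseteq> {..n}" using P by (auto simp: P_def)
    then show "finite (k n ` space M)" by (rule finite_subset) simp
    note [measurable] = meas
    show "k n \<in> M \<rightarrow>\<^sub>M count_space UNIV" unfolding k_def P_def by measurable
  qed
  then have "simple_function M (\<lambda>x. e (k n x))" for n
    by (rule simple_function_compose1)
  moreover have "(\<lambda>n. e (k n x)) \<longlonglongrightarrow> f x" if "x \<in> space M" for x
  proof (rule metric_LIMSEQ_I)
    fix \<epsilon> :: real assume "0 < \<epsilon>"
    moreover have "f x \<in> closure D" using assms(2) that by blast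
    ultimately obtain d where "d \<in> D" "dist d (f x) < \<epsilon>"
      unfolding closure_approachable by blast
    then obtain j where j: "dist (e j) (f x) < \<epsilon>" using e by auto
    have "dist (e (k n x)) (f x) < \<epsilon>" if "n \<ge> j" for n
    proof -
      have "dist (f x) (e (k n x)) \<le> dist (f x) (e j)" using P[of n x] that unfolding P_def by simp
      then show ?thesis using j by (simp add: dist_commute)
    qed
    then show "\<exists>n0. \<forall>n\<ge>n0. dist (e (k n x)) (f x) < \<epsilon>" by blast
  qed
  ultimately show ?thesis
    unfolding strongly_measurable_def by (intro exI[of _ "\<lambda>n x. e (k n x)"]) auto
qed

lemma strongly_measurable_LIMSEQ:
  fixes f :: "'w \<Rightarrow> 'a::metric_space"
  assumes s: "\<And>n::nat. strongly_measurable M (s n)"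
    and lim: "\<And>x. x \<in> space M \<Longrightarrow> (\<lambda>n. s n x) \<longlonglongrightarrow> f x"
  shows "strongly_measurable M f"
proof -
  obtain D where D: "\<And>n. countable (D n)" "\<And>n. s n ` space M \<subseteq> closure (D n)"
    using strongly_measurable_separable_range[OF s] by metis
  have f: "f \<in> borel_measurable M"
    by (rule borel_measurable_LIMSEQ_metric[OF strongly_measurable_borel[OF s] lim])
  show ?thesis
  proof (rule strongly_measurableI)
    show "countable (\<Union>n. D n)" using D(1) by blast
    have "s n x \<in> closure (\<Union>n. D n)" if "x \<in> space M" for n x
      using D(2)[of n] that closure_mono[of "D n" "\<Union>n. D n"] by blast
    then have "f x \<in> closure (\<Union>n. D n)" if "x \<in> space M" for x
      using closed_sequentially[OF closed_closure _ lim[OF that]] that by blast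
    then show "f ` space M \<subseteq> closure (\<Union>n. D n)" by blast
  qed (rule borel_measurable_dist_const[OF f])
qed

text \<open>F is a Caratheodory function: measurable in w, continuous in x. Along a simple function
  only finitely many \<open>F x\<close> occur, so the range stays separable; continuity carries the
  result to the limit. Every application of a varying operator to a varying vector below rests on
  this.\<close>

lemma strongly_measurable_compose:
  fixes F :: "'a::metric_space \<Rightarrow> 'w \<Rightarrow> 'b::metric_space"
  assumes F: "\<And>x. strongly_measurable M (F x)"
    and cont: "\<And>w. w \<in> space M \<Longrightarrow> continuous_on UNIV (\<lambda>x. F x w)"
    and g: "strongly_measurable M g"
  shows "strongly_measurable M (\<lambda>w. F (g w) w)"
proof -
  obtain s where s: "\<And>n::nat. simple_function M (s n)" "\<And>x. x \<in> space M \<Longrightarrow> (\<lambda>n. s n x) \<longlonglongrightarrow> g x"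
    using g unfolding strongly_measurable_def by blast
  show ?thesis
  proof (rule strongly_measurable_LIMSEQ)
    fix n
    obtain D where D: "\<And>x. countable (D x)" "\<And>x. F x ` space M \<subseteq> closure (D x)"
      using strongly_measurable_separable_range[OF F] by metis
    let ?R = "s n ` space M"
    have R: "finite ?R" by (rule simple_functionD(1)[OF s(1)])
    show "strongly_measurable M (\<lambda>w. F (s n w) w)"
    proof (rule strongly_measurableI)
      show "countable (\<Union>x\<in>?R. D x)" using D(1) countable_finite[OF R] by blast
      show "(\<lambda>w. F (s n w) w) ` space M \<subseteq> closure (\<Union>x\<in>?R. D x)"
      proof safe
        fix w assume w: "w \<in> space M"
        then have "closure (D (s n w)) \<subseteq> closure (\<Union>x\<in>?R. D x)" by (intro closure_mono) blast
        then show "F (s n w) w \<in> closure (\<Union>x\<in>?R. D x)" using D(2) w by blast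
      qed
      fix d
      show "(\<lambda>w. dist (F (s n w) w) d) \<in> borel_measurable M"
      proof (rule measurable_compose_countable'[of ?R "\<lambda>x w. dist (F x w) d"])
        show "(\<lambda>w. dist (F x w) d) \<in> borel_measurable M" for x
          by (rule borel_measurable_dist_const[OF strongly_measurable_borel[OF F]])
        show "s n \<in> M \<rightarrow>\<^sub>M count_space ?R"
          using measurable_simple_function[OF s(1)[of n]]
          by (auto intro: measurable_count_space_extend)
      qed (rule countable_finite[OF R])
    qed
  next
    fix w assume w: "w \<in> space M"
    show "(\<lambda>n. F (s n w) w) \<longlonglongrightarrow> F (g w) w"
      using continuous_on_tendsto_compose[OF cont[OF w] s(2)[OF w]] by simp
  qed
qed

lemma strongly_measurable_const: "strongly_measurable M (\<lambda>w. c)"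
  unfolding strongly_measurable_def by (intro exI[of _ "\<lambda>n w. c"]) auto

lemma strongly_measurable_continuous:
  assumes "continuous_on UNIV h" "strongly_measurable M f"
  shows "strongly_measurable M (\<lambda>w. h (f w))"
  by (rule strongly_measurable_compose[of M "\<lambda>x w. h x", OF strongly_measurable_const assms])

lemma borel_imp_strongly_measurable:
  fixes f :: "'w \<Rightarrow> 'a::{metric_space, second_countable_topology}"
  assumes "f \<in> borel_measurable M"
  shows "strongly_measurable M f"
  using borel_measurable_implies_sequence_metric[OF assms] unfolding strongly_measurable_def by blast

lemma strongly_measurable_scaleR:
  fixes f :: "'w \<Rightarrow> 'a::real_normed_vector"
  assumes \<alpha>: "\<alpha> \<in> borel_measurable M" and f: "strongly_measurable M f"
  shows "strongly_measurable M (\<lambda>w. \<alpha> w *\<^sub>R f w)"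
proof (rule strongly_measurable_compose[of M "\<lambda>x w. \<alpha> w *\<^sub>R x", OF _ _ f])
  show "strongly_measurable M (\<lambda>w. \<alpha> w *\<^sub>R x)" for x :: 'a
    by (rule strongly_measurable_continuous[OF _ borel_imp_strongly_measurable[OF \<alpha>]])
      (rule linear_continuous_on[OF bounded_linear_scaleR_left])
  show "continuous_on UNIV (\<lambda>x. \<alpha> w *\<^sub>R x :: 'a)" for w by (intro continuous_intros)
qed

lemma strongly_measurable_pullback:
  assumes g: "g \<in> T \<rightarrow>\<^sub>M M" and f: "strongly_measurable M f"
  shows "strongly_measurable T (\<lambda>x. f (g x))"
proof -
  obtain D where D: "countable D" "f ` space M \<subseteq> closure D"
    using strongly_measurable_separable_range[OF f] by blast
  then show ?thesis
    using measurable_space[OF g]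
    by (intro strongly_measurableI[OF D(1)] borel_measurable_dist_const
        measurable_compose[OF g strongly_measurable_borel[OF f]]) blast
qed

text \<open>Varying one argument at a time avoids the Borel structure of the product space, which is
  problematic without separability.\<close>

lemma (in hilbert_space) borel_measurable_ip:
  assumes f: "strongly_measurable M f" and g: "strongly_measurable M g"
  shows "(\<lambda>w. ip (f w) (g w)) \<in> borel_measurable M"
proof (rule strongly_measurable_borel)
  show "strongly_measurable M (\<lambda>w. ip (f w) (g w))"
  proof (rule strongly_measurable_compose[of M "\<lambda>x w. ip x (g w)", OF _ _ f])
    show "strongly_measurable M (\<lambda>w. ip x (g w))" for x
      by (rule strongly_measurable_continuous[OF _ g])
        (rule linear_continuous_on[OF bounded_linear_ip_right])
    show "continuous_on UNIV (\<lambda>x. ip x (g w))" for w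
      by (rule linear_continuous_on[OF bounded_linear_ip_left])
  qed
qed

text \<open>
  The projection of \<open>x\<close> to \<open>T V\<close>, where \<open>T = S\<^sup>-\<^sup>1\<close>, is \<open>T u\<close> for the minimizer \<open>u \<in> V\<close> of
  \<open>norm (x - T u)\<close>. Gradient descent finds it as a limit of functions whose measurability is clear.
\<close>

lemma (in positive_definite_op) strongly_measurable_orth_proj_inv_image:
  assumes V: "\<And>w. w \<in> space Q \<Longrightarrow> closed_subspace scl (V w)"
    and meas: "\<And>x. strongly_measurable Q (\<lambda>w. orth_proj ip (V w) x)"
  shows "strongly_measurable Q (\<lambda>w. orth_proj ip (inv S ` V w) x)"
proof -
  note lin = linear_simps[OF bounded_linear_inv]
  have bl_P: "Real_Vector_Spaces.bounded_linear (orth_proj ip (V w))" if "w \<in> space Q" for w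
    by (rule bounded_op_bounded_linear[OF hilbert_space_axioms hilbert_space_axioms
          bounded_op_orth_proj[OF V[OF that]]])
  note cont_T = bounded_linear.continuous_on[OF bounded_linear_inv]
  obtain m where m: "0 < m" "\<And>x. m * norm x \<le> norm (inv S x)" using norm_inv_ge by blast
  obtain L where L: "0 < L" "\<And>x. norm (inv S x) \<le> norm x * L"
    using bounded_linear.pos_bounded[OF bounded_linear_inv] by blast
  \<comment> \<open>One step multiplies the squared error by at most
    \<open>1 - 2 * c * m^2 + c^2 * L^4\<close>. This c minimizes the factor, and the minimum is the
    q defined below.\<close>
  define c where "c = m\<^sup>2 / L ^ 4"
  have c: "0 < c" using m L by (simp add: c_def)
  \<comment> \<open>With T for \<open>inv S\<close>, the vector \<open>T (T y - x)\<close> is the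
    gradient of half the squared distance from \<open>T y\<close> to x, as T is self-adjoint;
    projecting it keeps the iterates in \<open>V w\<close>.\<close>
  define step where "step y w = y - c *\<^sub>R orth_proj ip (V w) (inv S (inv S y - x))" for y w
  define u where "u n w = ((\<lambda>y. step y w) ^^ n) 0" for n w
  have step_meas: "strongly_measurable Q (step y)" for y
    unfolding step_def
    by (rule strongly_measurable_continuous[OF _ meas, where h = "\<lambda>z. y - c *\<^sub>R z"]) (intro continuous_intros)
  have step_cont: "continuous_on UNIV (\<lambda>y. step y w)" if "w \<in> space Q" for w
    unfolding step_def
    by (intro continuous_intros bounded_linear.continuous_on[OF bl_P[OF that]] cont_T)
  have u_meas: "strongly_measurable Q (u n)" for n
  proof (induction n)
    case 0
    then show ?case by (simp add: u_def[abs_def] strongly_measurable_const)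
  next
    case (Suc n)
    have "u (Suc n) = (\<lambda>w. step (u n w) w)" by (simp add: u_def fun_eq_iff)
    then show ?case using strongly_measurable_compose[OF step_meas step_cont Suc] by simp
  qed
  show ?thesis
  proof (rule strongly_measurable_LIMSEQ)
    show "strongly_measurable Q (\<lambda>w. inv S (u n w))" for n
      by (rule strongly_measurable_continuous[OF cont_T[OF continuous_on_id] u_meas])
  next
    fix w assume w: "w \<in> space Q"
    let ?P = "orth_proj ip (V w)"
    note P = linear_simps[OF bl_P[OF w]]
    note cs = closed_subspaceD[OF V[OF w]]
    have TV: "closed_subspace scl (inv S ` V w)" by (rule closed_subspace_inv_image[OF V[OF w]])
    obtain v where v: "v \<in> V w" "orth_proj ip (inv S ` V w) x = inv S v"
      using orth_proj_mem[OF TV, of x] by blast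
    \<comment> \<open>The normal equation: v is a fixed point of \<open>step\<close>, so the error
      of the iterates evolves linearly, independently of x.\<close>
    have stationary: "?P (inv S (inv S v - x)) = 0"
    proof (rule orth_proj_unique[OF V[OF w] cs(2)])
      fix z assume "z \<in> V w"
      then have "ip (x - inv S v) (inv S z) = 0"
        using orth_proj_orthogonal[OF TV, of "inv S z" x] v(2) by simp
      then have "ip (inv S v - x) (inv S z) = 0"
        by (simp add: ip_diff_left)
      then show "ip (inv S (inv S v - x) - 0) z = 0" by (simp add: inv_self_adjoint)
    qed
    define q where "q = 1 - m ^ 4 / L ^ 4"
    \<comment> \<open>For y in \<open>V w\<close> the cross term of the expanded square is the
      squared norm of \<open>inv S y\<close>, bounded below through m; the quadratic term is bounded
      above through L.\<close>
    have contract: "(norm (y - c *\<^sub>R ?P (inv S (inv S y))))\<^sup>2 \<le> q * (norm y)\<^sup>2" if y: "y \<in> V w" for y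
    proof -
      let ?z = "?P (inv S (inv S y))"
      have "ip y ?z = ip (inv S y) (inv S y)"
        using ip_orth_proj_right[OF V[OF w] y] inv_self_adjoint[of y "inv S y"] by simp
      then have yz: "ip y ?z = of_real ((norm (inv S y))\<^sup>2)" by (simp add: ip_self)
      then have zy: "ip ?z y = of_real ((norm (inv S y))\<^sup>2)"
        by (metis conjg_of_real ip_commute)
      have "ip (y - c *\<^sub>R ?z) (y - c *\<^sub>R ?z)
          = of_real ((norm y)\<^sup>2 - 2 * c * (norm (inv S y))\<^sup>2 + c\<^sup>2 * (norm ?z)\<^sup>2)"
        unfolding ip_diff_left ip_diff_right ip_scaleR_left ip_scaleR_right yz zy ip_self[of y] ip_self[of ?z]
        by (simp add: scaleR_conv_of_real power2_eq_square algebra_simps)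
      then have eq: "(norm (y - c *\<^sub>R ?z))\<^sup>2 = (norm y)\<^sup>2 - 2 * c * (norm (inv S y))\<^sup>2 + c\<^sup>2 * (norm ?z)\<^sup>2"
        unfolding ip_self of_real_eq_iff .
      have "norm ?z \<le> norm (inv S (inv S y))" by (rule norm_orth_proj_le[OF V[OF w]])
      also have "\<dots> \<le> norm (inv S y) * L" by (rule L)
      also have "\<dots> \<le> norm y * L * L" by (intro mult_right_mono L(2) less_imp_le L(1))
      finally have "norm ?z \<le> norm y * L\<^sup>2" by (simp add: power2_eq_square mult_ac)
      then have "(norm ?z)\<^sup>2 \<le> (norm y * L\<^sup>2)\<^sup>2" by (intro power_mono) auto
      then have z_le: "c\<^sup>2 * (norm ?z)\<^sup>2 \<le> c\<^sup>2 * (norm y * L\<^sup>2)\<^sup>2" by (intro mult_left_mono) auto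
      have "(m * norm y)\<^sup>2 \<le> (norm (inv S y))\<^sup>2" using m by (intro power_mono) auto
      then have "2 * c * (m * norm y)\<^sup>2 \<le> 2 * c * (norm (inv S y))\<^sup>2"
        using c by (intro mult_left_mono) auto
      then have "(norm (y - c *\<^sub>R ?z))\<^sup>2 \<le> (norm y)\<^sup>2 - 2 * c * (m * norm y)\<^sup>2 + c\<^sup>2 * (norm y * L\<^sup>2)\<^sup>2"
        using eq z_le by linarith
      also have "\<dots> = q * (norm y)\<^sup>2"
      proof -
        have "c\<^sup>2 * (norm y * L\<^sup>2)\<^sup>2 = (c * L ^ 4) * c * (norm y)\<^sup>2"
          by (simp add: power2_eq_square power4_eq_xxxx algebra_simps)
        also have "c * L ^ 4 = m\<^sup>2" using L by (simp add: c_def)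
        finally have "c\<^sup>2 * (norm y * L\<^sup>2)\<^sup>2 = m\<^sup>2 * c * (norm y)\<^sup>2" .
        moreover have "q = 1 - c * m\<^sup>2"
          by (simp add: q_def c_def power2_eq_square power4_eq_xxxx)
        ultimately show ?thesis by (simp only:) (simp add: power_mult_distrib algebra_simps)
      qed
      finally show ?thesis .
    qed
    \<comment> \<open>On the zero space m may exceed L and q be negative, so the powers are taken of
      \<open>max q 0\<close>.\<close>
    have u: "u n w \<in> V w \<and> (norm (u n w - v))\<^sup>2 \<le> max q 0 ^ n * (norm v)\<^sup>2" for n
    proof (induction n)
      case 0
      then show ?case by (simp add: u_def cs)
    next
      case (Suc n)
      then have IH: "u n w \<in> V w" "(norm (u n w - v))\<^sup>2 \<le> max q 0 ^ n * (norm v)\<^sup>2" by blast+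
      have Suc_n: "u (Suc n) w = step (u n w) w" by (simp add: u_def)
      have "?P (inv S (inv S (u n w) - x)) = ?P (inv S (inv S (u n w - v)))"
        using stationary by (simp add: lin P)
      then have "u (Suc n) w - v = (u n w - v) - c *\<^sub>R ?P (inv S (inv S (u n w - v)))"
        by (simp add: Suc_n step_def)
      then have "(norm (u (Suc n) w - v))\<^sup>2 \<le> q * (norm (u n w - v))\<^sup>2"
        using contract[OF cs(5)[OF IH(1) v(1)]] by (simp only:)
      also have "\<dots> \<le> max q 0 * (norm (u n w - v))\<^sup>2" by (intro mult_right_mono) auto
      also have "\<dots> \<le> max q 0 * (max q 0 ^ n * (norm v)\<^sup>2)" by (intro mult_left_mono IH(2)) auto
      finally show ?case
        using IH(1) by (auto simp: Suc_n step_def mult.assoc intro!: cs orth_proj_mem[OF V[OF w]])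
    qed
    have "max q 0 < 1" using m L by (simp add: q_def)
    then have lim: "(\<lambda>n. max q 0 ^ n * (norm v)\<^sup>2) \<longlonglongrightarrow> 0"
      by (intro tendsto_mult_left_zero LIMSEQ_power_zero) simp
    have "(\<lambda>n. (norm (u n w - v))\<^sup>2) \<longlonglongrightarrow> 0"
      by (rule tendsto_sandwich[OF _ _ tendsto_const lim]) (simp_all add: u)
    then have "(\<lambda>n. sqrt ((norm (u n w - v))\<^sup>2)) \<longlonglongrightarrow> sqrt 0" by (rule tendsto_real_sqrt)
    then have "(\<lambda>n. u n w) \<longlonglongrightarrow> v"
      by (simp add: LIM_zero_iff tendsto_norm_zero_iff)
    then show "(\<lambda>n. inv S (u n w)) \<longlonglongrightarrow> orth_proj ip (inv S ` V w) x"
      unfolding v(2) by (rule bounded_linear.tendsto[OF bounded_linear_inv])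
  qed
qed

subsection \<open>Iterated integrals over a measurable bundle\<close>

locale measure_bundle =
  fixes M :: "'w measure" and N :: "'w \<Rightarrow> 'v measure" and T :: "('w \<times> 'v) measure"
  assumes measurable_bundle: "measurable_bundle M N T"
begin

lemma fst_measurable: "fst \<in> T \<rightarrow>\<^sub>M M"
  and in_space_TD: "x \<in> space T \<Longrightarrow> fst x \<in> space M \<and> snd x \<in> space (N (fst x))"
  using measurable_bundle unfolding measurable_bundle_def by auto

lemma section_ennreal:
  fixes g :: "'w \<Rightarrow> 'v \<Rightarrow> ennreal"
  assumes "(\<lambda>(w, v). g w v) \<in> borel_measurable T"
  shows "w \<in> space M \<Longrightarrow> g w \<in> borel_measurable (N w)"
    and "(\<lambda>w. \<integral>\<^sup>+v. g w v \<partial>N w) \<in> borel_measurable M"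
  using measurable_bundle assms unfolding measurable_bundle_def by fastforce+

text \<open>The bundle axioms cover \<open>ennreal\<close> values only, hence the split into
  positive and negative parts. The explicit conditional reproduces the value 0 of the integral on
  sections that are not integrable.\<close>

lemma section_real:
  fixes h :: "'w \<Rightarrow> 'v \<Rightarrow> real"
  assumes h: "(\<lambda>(w, v). h w v) \<in> borel_measurable T"
  shows "w \<in> space M \<Longrightarrow> h w \<in> borel_measurable (N w)"
    and "(\<lambda>w. LINT v|N w. h w v) \<in> borel_measurable M"
proof -
  have pos: "(\<lambda>(w, v). ennreal (h w v)) \<in> borel_measurable T"
    and neg: "(\<lambda>(w, v). ennreal (- h w v)) \<in> borel_measurable T"
    and abs: "(\<lambda>(w, v). ennreal (norm (h w v))) \<in> borel_measurable T"
    using h by (simp_all add: case_prod_beta')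
  have meas: "h w \<in> borel_measurable (N w)" if w: "w \<in> space M" for w
  proof -
    have "(\<lambda>v. enn2real (ennreal (h w v)) - enn2real (ennreal (- h w v))) \<in> borel_measurable (N w)"
      using section_ennreal(1)[OF pos w] section_ennreal(1)[OF neg w] by measurable
    moreover have "enn2real (ennreal r) - enn2real (ennreal (- r)) = r" for r :: real
      by (cases "0 \<le> r") (simp_all add: ennreal_neg)
    ultimately show ?thesis by simp
  qed
  then show "w \<in> space M \<Longrightarrow> h w \<in> borel_measurable (N w)" .
  have "(\<lambda>w. if (\<integral>\<^sup>+v. ennreal (norm (h w v)) \<partial>N w) < \<infinity>
      then enn2real (\<integral>\<^sup>+v. ennreal (h w v) \<partial>N w) - enn2real (\<integral>\<^sup>+v. ennreal (- h w v) \<partial>N w)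
      else 0) \<in> borel_measurable M"
    using section_ennreal(2)[OF pos] section_ennreal(2)[OF neg] section_ennreal(2)[OF abs]
    by measurable
  moreover have "(LINT v|N w. h w v) = (if (\<integral>\<^sup>+v. ennreal (norm (h w v)) \<partial>N w) < \<infinity>
      then enn2real (\<integral>\<^sup>+v. ennreal (h w v) \<partial>N w) - enn2real (\<integral>\<^sup>+v. ennreal (- h w v) \<partial>N w)
      else 0)" if w: "w \<in> space M" for w
  proof (cases "(\<integral>\<^sup>+v. ennreal (norm (h w v)) \<partial>N w) < \<infinity>")
    case True
    then have "integrable (N w) (h w)" using meas[OF w] by (simp add: integrable_iff_bounded)
    then show ?thesis using True by (simp add: real_lebesgue_integral_def)
  next
    case False
    then have "\<not> integrable (N w) (h w)" by (simp add: integrable_iff_bounded)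
    then show ?thesis using False by (simp add: not_integrable_integral_eq)
  qed
  ultimately show "(\<lambda>w. LINT v|N w. h w v) \<in> borel_measurable M"
    by (simp cong: measurable_cong)
qed

text \<open>Reduction to real functions by \<open>scalar_decomposition\<close>, whose coordinate
  maps commute with the integral of an integrable section.\<close>

lemma section_scalar:
  fixes h :: "'w \<Rightarrow> 'v \<Rightarrow> 'k::real_or_complex"
  assumes h: "(\<lambda>(w, v). h w v) \<in> borel_measurable T"
  shows "w \<in> space M \<Longrightarrow> h w \<in> borel_measurable (N w)"
    and "(\<lambda>w. LINT v|N w. h w v) \<in> borel_measurable M"
proof -
  obtain re im :: "'k \<Rightarrow> real" and j where re: "bounded_linear re" and im: "bounded_linear im"
    and decomp: "\<And>x. x = of_real (re x) + of_real (im x) * j"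
    using scalar_decomposition by blast
  have "(\<lambda>(w, v). re (h w v)) \<in> borel_measurable T" "(\<lambda>(w, v). im (h w v)) \<in> borel_measurable T"
    using borel_measurable_continuous_on[OF linear_continuous_on[OF re] h]
      borel_measurable_continuous_on[OF linear_continuous_on[OF im] h]
    by (simp_all add: case_prod_beta')
  note re_sec = section_real[OF this(1)] and im_sec = section_real[OF this(2)]
  have abs: "(\<lambda>(w, v). ennreal (norm (h w v))) \<in> borel_measurable T"
    using h by (simp add: case_prod_beta')
  have meas: "h w \<in> borel_measurable (N w)" if w: "w \<in> space M" for w
  proof -
    have "(\<lambda>v. of_real (re (h w v)) + of_real (im (h w v)) * j) \<in> borel_measurable (N w)"
      using re_sec(1)[OF w] im_sec(1)[OF w] by measurable
    then show ?thesis by (simp flip: decomp)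
  qed
  then show "w \<in> space M \<Longrightarrow> h w \<in> borel_measurable (N w)" .
  have "(\<lambda>w. if (\<integral>\<^sup>+v. ennreal (norm (h w v)) \<partial>N w) < \<infinity>
      then of_real (LINT v|N w. re (h w v)) + of_real (LINT v|N w. im (h w v)) * j
      else 0) \<in> borel_measurable M"
    using re_sec(2) im_sec(2) section_ennreal(2)[OF abs] by measurable
  moreover have "(LINT v|N w. h w v) = (if (\<integral>\<^sup>+v. ennreal (norm (h w v)) \<partial>N w) < \<infinity>
      then of_real (LINT v|N w. re (h w v)) + of_real (LINT v|N w. im (h w v)) * j
      else 0)" if w: "w \<in> space M" for w
  proof (cases "(\<integral>\<^sup>+v. ennreal (norm (h w v)) \<partial>N w) < \<infinity>")
    case True
    then have int: "integrable (N w) (h w)" using meas[OF w] by (simp add: integrable_iff_bounded)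
    then show ?thesis
      using True decomp[of "LINT v|N w. h w v"] integral_bounded_linear[OF re int]
        integral_bounded_linear[OF im int] by simp
  next
    case False
    then have "\<not> integrable (N w) (h w)" by (simp add: integrable_iff_bounded)
    then show ?thesis using False by (simp add: not_integrable_integral_eq)
  qed
  ultimately show "(\<lambda>w. LINT v|N w. h w v) \<in> borel_measurable M"
    by (simp cong: measurable_cong)
qed

text \<open>Tonelli-style absolute integrability. A bundle comes with no product measure, so
  finiteness is asked of the iterated integral.\<close>

definition iterated_integrable :: "('w \<Rightarrow> 'v \<Rightarrow> 'k::real_or_complex) \<Rightarrow> bool" where
  "iterated_integrable h \<longleftrightarrow> (\<lambda>(w, v). h w v) \<in> borel_measurable T \<and>
    (\<integral>\<^sup>+w. \<integral>\<^sup>+v. ennreal (norm (h w v)) \<partial>N w \<partial>M) < \<infinity>"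

lemma iterated_integrableD:
  assumes "iterated_integrable h"
  shows "AE w in M. integrable (N w) (h w)"
    and "integrable M (\<lambda>w. LINT v|N w. h w v)"
    and "ennreal (norm (LINT w|M. LINT v|N w. h w v))
      \<le> (\<integral>\<^sup>+w. \<integral>\<^sup>+v. ennreal (norm (h w v)) \<partial>N w \<partial>M)"
proof -
  have h: "(\<lambda>(w, v). h w v) \<in> borel_measurable T"
    and fin: "(\<integral>\<^sup>+w. \<integral>\<^sup>+v. ennreal (norm (h w v)) \<partial>N w \<partial>M) < \<infinity>"
    using assms by (simp_all add: iterated_integrable_def)
  have "(\<lambda>(w, v). ennreal (norm (h w v))) \<in> borel_measurable T"
    using h by (simp add: case_prod_beta')
  from nn_integral_PInf_AE[OF section_ennreal(2)[OF this]]
  have "AE w in M. (\<integral>\<^sup>+v. ennreal (norm (h w v)) \<partial>N w) \<noteq> \<infinity>" using fin by simp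
  then show "AE w in M. integrable (N w) (h w)"
    using AE_space
    by eventually_elim (simp add: integrable_iff_bounded section_scalar(1)[OF h] less_top)
  \<comment> \<open>Valid for every w, since a section that is not integrable has integral
    0.\<close>
  have "ennreal (norm (LINT v|N w. h w v)) \<le> (\<integral>\<^sup>+v. ennreal (norm (h w v)) \<partial>N w)" for w
    by (cases "integrable (N w) (h w)")
      (simp_all add: integral_norm_bound_ennreal not_integrable_integral_eq)
  then have le: "(\<integral>\<^sup>+w. ennreal (norm (LINT v|N w. h w v)) \<partial>M)
      \<le> (\<integral>\<^sup>+w. \<integral>\<^sup>+v. ennreal (norm (h w v)) \<partial>N w \<partial>M)"
    by (intro nn_integral_mono)
  then show int: "integrable M (\<lambda>w. LINT v|N w. h w v)"
    using fin section_scalar(2)[OF h] by (simp add: integrable_iff_bounded)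
  show "ennreal (norm (LINT w|M. LINT v|N w. h w v))
      \<le> (\<integral>\<^sup>+w. \<integral>\<^sup>+v. ennreal (norm (h w v)) \<partial>N w \<partial>M)"
    using integral_norm_bound_ennreal[OF int] le by (rule order_trans)
qed

lemma iterated_integral_add:
  assumes h1: "iterated_integrable h1" and h2: "iterated_integrable h2"
  shows "(LINT w|M. LINT v|N w. h1 w v + h2 w v)
    = (LINT w|M. LINT v|N w. h1 w v) + (LINT w|M. LINT v|N w. h2 w v)"
proof -
  have m: "(\<lambda>(w, v). h1 w v) \<in> borel_measurable T" "(\<lambda>(w, v). h2 w v) \<in> borel_measurable T"
    using assms by (simp_all add: iterated_integrable_def)
  then have m12: "(\<lambda>(w, v). h1 w v + h2 w v) \<in> borel_measurable T"
    by (simp add: case_prod_beta')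
  have "(LINT w|M. LINT v|N w. h1 w v + h2 w v)
      = (LINT w|M. (LINT v|N w. h1 w v) + (LINT v|N w. h2 w v))"
  proof (rule integral_cong_AE)
    show "AE w in M. (LINT v|N w. h1 w v + h2 w v) = (LINT v|N w. h1 w v) + (LINT v|N w. h2 w v)"
      using iterated_integrableD(1)[OF h1] iterated_integrableD(1)[OF h2] by eventually_elim simp
    show "(\<lambda>w. (LINT v|N w. h1 w v) + (LINT v|N w. h2 w v)) \<in> borel_measurable M"
      using section_scalar(2)[OF m(1)] section_scalar(2)[OF m(2)] by simp
  qed (rule section_scalar(2)[OF m12])
  also have "\<dots> = (LINT w|M. LINT v|N w. h1 w v) + (LINT w|M. LINT v|N w. h2 w v)"
    by (intro Bochner_Integration.integral_add iterated_integrableD(2) assms)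
  finally show ?thesis .
qed

text \<open>The bridge between the extended nonnegative integral of the frame condition and the
  scalar integral that defines the form on the diagonal.\<close>

lemma iterated_integral_of_real_nonneg:
  fixes n :: "'w \<Rightarrow> 'v \<Rightarrow> real"
  assumes n: "iterated_integrable n" and nonneg: "\<And>w v. 0 \<le> n w v"
  shows "(LINT w|M. LINT v|N w. (of_real (n w v) :: 'k::real_or_complex))
    = of_real (enn2real (\<integral>\<^sup>+w. \<integral>\<^sup>+v. ennreal (n w v) \<partial>N w \<partial>M))"
proof -
  have m: "(\<lambda>(w, v). n w v) \<in> borel_measurable T" using n by (simp add: iterated_integrable_def)
  have m': "(\<lambda>(w, v). (of_real (n w v) :: 'k)) \<in> borel_measurable T"
    using m by (simp add: case_prod_beta')
  have "(LINT w|M. LINT v|N w. (of_real (n w v) :: 'k)) = (LINT w|M. of_real (LINT v|N w. n w v))"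
  proof (rule integral_cong_AE)
    show "AE w in M. (LINT v|N w. (of_real (n w v) :: 'k)) = of_real (LINT v|N w. n w v)"
      using iterated_integrableD(1)[OF n] by eventually_elim simp
    show "(\<lambda>w. of_real (LINT v|N w. n w v) :: 'k) \<in> borel_measurable M"
      using section_real(2)[OF m] by simp
  qed (rule section_scalar(2)[OF m'])
  also have "\<dots> = of_real (LINT w|M. LINT v|N w. n w v)"
    by (rule integral_of_real) (rule iterated_integrableD(2)[OF n])
  also have "(LINT w|M. LINT v|N w. n w v) = enn2real (\<integral>\<^sup>+w. ennreal (LINT v|N w. n w v) \<partial>M)"
    by (rule integral_eq_nn_integral) (auto simp: section_real(2)[OF m] nonneg intro!: Bochner_Integration.integral_nonneg)
  also have "(\<integral>\<^sup>+w. ennreal (LINT v|N w. n w v) \<partial>M) = (\<integral>\<^sup>+w. \<integral>\<^sup>+v. ennreal (n w v) \<partial>N w \<partial>M)"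
  proof (rule nn_integral_cong_AE)
    show "AE w in M. ennreal (LINT v|N w. n w v) = (\<integral>\<^sup>+v. ennreal (n w v) \<partial>N w)"
      using iterated_integrableD(1)[OF n]
      by eventually_elim (simp add: nn_integral_eq_integral nonneg)
  qed
  finally show ?thesis .
qed

lemma nn_integral2_mono:
  "(\<And>w v. w \<in> space M \<Longrightarrow> v \<in> space (N w) \<Longrightarrow> f w v \<le> g w v)
    \<Longrightarrow> (\<integral>\<^sup>+w. \<integral>\<^sup>+v. f w v \<partial>N w \<partial>M) \<le> (\<integral>\<^sup>+w. \<integral>\<^sup>+v. g w v \<partial>N w \<partial>M)"
  by (intro nn_integral_mono) blast

lemma nn_integral2_add:
  assumes f: "(\<lambda>(w, v). f w v) \<in> borel_measurable T" and g: "(\<lambda>(w, v). g w v) \<in> borel_measurable T"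
  shows "(\<integral>\<^sup>+w. \<integral>\<^sup>+v. f w v + g w v \<partial>N w \<partial>M)
    = (\<integral>\<^sup>+w. \<integral>\<^sup>+v. f w v \<partial>N w \<partial>M) + (\<integral>\<^sup>+w. \<integral>\<^sup>+v. g w v \<partial>N w \<partial>M)"
proof -
  have "(\<integral>\<^sup>+w. \<integral>\<^sup>+v. f w v + g w v \<partial>N w \<partial>M) = (\<integral>\<^sup>+w. (\<integral>\<^sup>+v. f w v \<partial>N w) + (\<integral>\<^sup>+v. g w v \<partial>N w) \<partial>M)"
    by (intro nn_integral_cong nn_integral_add section_ennreal(1) f g)
  then show ?thesis using section_ennreal(2)[OF f] section_ennreal(2)[OF g] by (simp add: nn_integral_add)
qed

lemma nn_integral2_cmult:
  assumes f: "(\<lambda>(w, v). f w v) \<in> borel_measurable T"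
  shows "(\<integral>\<^sup>+w. \<integral>\<^sup>+v. c * f w v \<partial>N w \<partial>M) = c * (\<integral>\<^sup>+w. \<integral>\<^sup>+v. f w v \<partial>N w \<partial>M)"
proof -
  have "(\<integral>\<^sup>+w. \<integral>\<^sup>+v. c * f w v \<partial>N w \<partial>M) = (\<integral>\<^sup>+w. c * (\<integral>\<^sup>+v. f w v \<partial>N w) \<partial>M)"
    by (intro nn_integral_cong nn_integral_cmult section_ennreal(1) f)
  then show ?thesis using section_ennreal(2)[OF f] by (simp add: nn_integral_cmult)
qed

end

subsection \<open>Frame operators of operator-valued frames\<close>

text \<open>A continuous g-frame: operators into one fixed space, with no projections or weights
  left to track.\<close>

locale operator_frame =
  H: hilbert_space scH ipH + K: hilbert_space scK ipK + measure_bundle M N T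
  for scH :: "'k::real_or_complex \<Rightarrow> 'h::banach \<Rightarrow> 'h" and ipH :: "'h \<Rightarrow> 'h \<Rightarrow> 'k"
    and scK :: "'k \<Rightarrow> 'r::banach \<Rightarrow> 'r" and ipK :: "'r \<Rightarrow> 'r \<Rightarrow> 'k"
    and M :: "'w measure" and N :: "'w \<Rightarrow> 'v measure" and T :: "('w \<times> 'v) measure" +
  fixes L :: "'w \<Rightarrow> 'v \<Rightarrow> 'h \<Rightarrow> 'r" and A B :: real
  assumes L_add: "w \<in> space M \<Longrightarrow> v \<in> space (N w) \<Longrightarrow> L w v (f + g) = L w v f + L w v g"
    and L_scale: "w \<in> space M \<Longrightarrow> v \<in> space (N w) \<Longrightarrow> L w v (scH c f) = scK c (L w v f)"
    and L_meas: "strongly_measurable T (\<lambda>(w, v). L w v f)"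
    and A_pos: "0 < A"
    and frame_lower: "ennreal (A * (norm f)\<^sup>2) \<le> (\<integral>\<^sup>+w. \<integral>\<^sup>+v. ennreal ((norm (L w v f))\<^sup>2) \<partial>N w \<partial>M)"
    and frame_upper: "(\<integral>\<^sup>+w. \<integral>\<^sup>+v. ennreal ((norm (L w v f))\<^sup>2) \<partial>N w \<partial>M) \<le> ennreal (B * (norm f)\<^sup>2)"
begin

definition form :: "'h \<Rightarrow> 'h \<Rightarrow> 'k" where
  "form f g = (LINT w|M. LINT v|N w. ipK (L w v f) (L w v g))"

lemma ip_L_measurable: "(\<lambda>(w, v). ipK (L w v f) (L w v g)) \<in> borel_measurable T"
  using K.borel_measurable_ip[OF L_meas L_meas, of f g] by (simp add: case_prod_beta')

lemma norm_L_measurable: "(\<lambda>(w, v). (norm (L w v f))\<^sup>2) \<in> borel_measurable T"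
proof -
  have [measurable]: "(\<lambda>x. L (fst x) (snd x) f) \<in> borel_measurable T"
    using strongly_measurable_borel[OF L_meas[of f]] by (simp add: case_prod_beta')
  show ?thesis unfolding case_prod_beta' by measurable
qed

text \<open>The crude bound of \<open>norm (ipK x y)\<close> by the sum of the squared norms
  replaces a Hoelder inequality for iterated integrals. Since \<open>ennreal\<close> truncates a
  negative B to 0, \<open>max B 0\<close> is the constant that adds correctly.\<close>

lemma bound_ip_L:
  "(\<integral>\<^sup>+w. \<integral>\<^sup>+v. ennreal (norm (ipK (L w v f) (L w v g))) \<partial>N w \<partial>M)
    \<le> ennreal (max B 0 * ((norm f)\<^sup>2 + (norm g)\<^sup>2))"
proof -
  have m: "(\<lambda>(w, v). ennreal ((norm (L w v f))\<^sup>2)) \<in> borel_measurable T" for f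
    using norm_L_measurable[of f] by (simp add: case_prod_beta')
  have "norm (ipK x y) \<le> (norm x)\<^sup>2 + (norm y)\<^sup>2" for x y
  proof -
    have "2 * (norm x * norm y) \<le> (norm x)\<^sup>2 + (norm y)\<^sup>2"
      using sum_squares_bound[of "norm x" "norm y"] by simp
    moreover have "0 \<le> norm x * norm y" by simp
    ultimately show ?thesis using K.Cauchy_Schwarz[of x y] by linarith
  qed
  then have "(\<integral>\<^sup>+w. \<integral>\<^sup>+v. ennreal (norm (ipK (L w v f) (L w v g))) \<partial>N w \<partial>M)
      \<le> (\<integral>\<^sup>+w. \<integral>\<^sup>+v. ennreal ((norm (L w v f))\<^sup>2) + ennreal ((norm (L w v g))\<^sup>2) \<partial>N w \<partial>M)"
    by (intro nn_integral2_mono) (simp flip: ennreal_plus)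
  also have "\<dots> \<le> ennreal (B * (norm f)\<^sup>2) + ennreal (B * (norm g)\<^sup>2)"
    unfolding nn_integral2_add[OF m m] by (intro add_mono frame_upper)
  also have "\<dots> \<le> ennreal (max B 0 * (norm f)\<^sup>2) + ennreal (max B 0 * (norm g)\<^sup>2)"
    by (intro add_mono ennreal_leI mult_right_mono) auto
  also have "\<dots> = ennreal (max B 0 * ((norm f)\<^sup>2 + (norm g)\<^sup>2))"
    by (simp add: distrib_left flip: ennreal_plus)
  finally show ?thesis .
qed

lemma ip_L_integrable: "iterated_integrable (\<lambda>w v. ipK (L w v f) (L w v g))"
  unfolding iterated_integrable_def
  using ip_L_measurable bound_ip_L[of f g] by (auto intro: le_less_trans)

lemma norm_form_le_sum: "norm (form f g) \<le> max B 0 * ((norm f)\<^sup>2 + (norm g)\<^sup>2)"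
  using order_trans[OF iterated_integrableD(3)[OF ip_L_integrable] bound_ip_L[of f g]]
  by (simp add: form_def)

lemma iterated_LINT_cong:
  assumes "\<And>w v. w \<in> space M \<Longrightarrow> v \<in> space (N w) \<Longrightarrow> h w v = h' w v"
  shows "(LINT w|M. LINT v|N w. h w v) = (LINT w|M. LINT v|N w. h' w v)"
  by (intro Bochner_Integration.integral_cong refl assms)

lemma form_add: "form (f + f') g = form f g + form f' g"
  unfolding form_def iterated_integral_add[OF ip_L_integrable ip_L_integrable, symmetric]
  by (intro iterated_LINT_cong) (simp add: L_add K.ip_add_left)

lemma form_scale: "form (scH c f) g = c * form f g"
proof -
  have "form (scH c f) g = (LINT w|M. LINT v|N w. c * ipK (L w v f) (L w v g))"
    unfolding form_def by (intro iterated_LINT_cong) (simp add: L_scale K.ip_scale_left)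
  then show ?thesis by (simp add: form_def)
qed

lemma form_commute: "form g f = conjg (form f g)"
proof -
  \<comment> \<open>Conjugation is its own inverse, so it commutes with the integral whether or not
    h is integrable.\<close>
  have conjg_integral: "(LINT x|Q. conjg (h x)) = conjg (LINT x|Q. h x)"
    for Q :: "'z measure" and h :: "'z \<Rightarrow> 'k"
    by (rule integral_bounded_linear'[OF bounded_linear_conjg bounded_linear_conjg])
      (simp add: conjg_conjg)
  have "form g f = (LINT w|M. LINT v|N w. conjg (ipK (L w v f) (L w v g)))"
    unfolding form_def by (simp flip: K.ip_commute)
  then show ?thesis by (simp add: conjg_integral form_def)
qed

lemma form_scaleR: "form (r *\<^sub>R f) g = of_real r * form f g" "form f (r *\<^sub>R g) = of_real r * form f g"
proof -
  show *: "form (r *\<^sub>R f) g = of_real r * form f g" for f g by (simp only: H.scaleR_eq form_scale)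
  show "form f (r *\<^sub>R g) = of_real r * form f g"
    by (simp only: form_commute[where f = "r *\<^sub>R g" and g = f] form_commute[where f = g and g = f]
        * conjg_mult conjg_of_real)
qed

text \<open>Homogeneity upgrades the additive estimate to a product one after both arguments are
  normalized; the 2 is the sum of the two squared norms, each at most 1.\<close>

lemma norm_form_le: "norm (form f g) \<le> (2 * max B 0 * norm f) * norm g"
proof -
  \<comment> \<open>Division by zero makes \<open>u 0 = 0\<close>, so the properties of u need no
    case distinction.\<close>
  define u where "u x = (1 / norm x) *\<^sub>R x" for x :: 'h
  have u: "x = norm x *\<^sub>R u x" "(norm (u x))\<^sup>2 \<le> 1" for x by (simp_all add: u_def)
  have "norm (form f g) = norm (form (norm f *\<^sub>R u f) (norm g *\<^sub>R u g))" by (simp flip: u(1))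
  also have "\<dots> = norm f * norm g * norm (form (u f) (u g))"
    by (simp only: form_scaleR) (simp add: norm_mult)
  also have "\<dots> \<le> norm f * norm g * (max B 0 * 2)"
  proof (rule mult_left_mono)
    have "max B 0 * ((norm (u f))\<^sup>2 + (norm (u g))\<^sup>2) \<le> max B 0 * 2"
      using u(2)[of f] u(2)[of g] by (intro mult_left_mono) linarith+
    then show "norm (form (u f) (u g)) \<le> max B 0 * 2"
      using norm_form_le_sum[of "u f" "u g"] by linarith
  qed simp
  finally show ?thesis by (simp add: mult_ac)
qed

lemma form_self_ge: "A * (norm f)\<^sup>2 \<le> norm (form f f)"
proof -
  let ?E = "\<integral>\<^sup>+w. \<integral>\<^sup>+v. ennreal ((norm (L w v f))\<^sup>2) \<partial>N w \<partial>M"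
  have fin: "?E < \<infinity>" using frame_upper[of f] by (rule le_less_trans) simp
  have "iterated_integrable (\<lambda>w v. (norm (L w v f))\<^sup>2)"
    unfolding iterated_integrable_def using norm_L_measurable fin by simp
  from iterated_integral_of_real_nonneg[OF this]
  have "form f f = of_real (enn2real ?E)" unfolding form_def K.ip_self by simp
  then have "norm (form f f) = enn2real ?E" by simp
  moreover have "A * (norm f)\<^sup>2 \<le> enn2real ?E"
  proof -
    have "A * (norm f)\<^sup>2 = enn2real (ennreal (A * (norm f)\<^sup>2))" using A_pos by simp
    also have "\<dots> \<le> enn2real ?E" using fin by (intro enn2real_mono frame_lower) simp
    finally show ?thesis .
  qed
  ultimately show ?thesis by simp
qed

text \<open>Riesz represents functionals linear in their argument, so it is applied to
  \<open>form g f\<close> as a function of g; conjugate symmetry then moves S to the first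
  slot.\<close>

lemma frame_operator_exists:
  obtains S where "positive_definite_op scH ipH S A" "\<And>f g. ipH (S f) g = form f g"
proof -
  have "\<exists>z. \<forall>g. form g f = ipH g z" for f
    by (rule H.Riesz_representation[of "\<lambda>g. form g f" "2 * max B 0 * norm f"])
      (use norm_form_le[of _ f] in \<open>auto simp: form_add form_scale mult_ac\<close>)
  then obtain S where "\<And>f g. form g f = ipH g (S f)" by metis
  then have S: "ipH (S f) g = form f g" for f g by (metis H.ip_commute form_commute)
  have "positive_definite_op scH ipH S A"
  proof unfold_locales
    show "bounded_op scH scH S"
      unfolding bounded_op_def
    proof (intro conjI exI allI)
      show "Vector_Spaces.linear scH scH S"
      proof unfold_locales
        show "S (f + g) = S f + S g" for f g
          by (rule H.ip_eqI) (simp add: S H.ip_add_left form_add)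
        show "S (scH c f) = scH c (S f)" for c f
          by (rule H.ip_eqI) (simp add: S H.ip_scale_left form_scale)
      qed
      fix f
      have "(norm (S f))\<^sup>2 \<le> (2 * max B 0 * norm f) * norm (S f)"
        using norm_form_le[of f "S f"] by (simp flip: S)
      then show "norm (S f) \<le> 2 * max B 0 * norm f"
        by (cases "S f = 0") (simp_all add: power2_eq_square)
    qed
    show "ipH (S f) g = ipH f (S g)" for f g
      using form_commute[of f g] by (simp add: S flip: H.ip_commute[of f "S g"])
        (metis H.ip_commute S)
    show "A * (norm f)\<^sup>2 \<le> norm (ipH (S f) f)" for f using form_self_ge by (simp add: S)
  qed (rule A_pos)
  then show ?thesis using S by (rule that)
qed

text \<open>R moves the test vector: the identity serves the frame operator itself and the formula
  with the inverse applied to f; the inverse serves the formula with the inverse outside.\<close>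

lemma has_weak_integral_frame_operator:
  assumes S: "\<And>f g. ipH (S f) g = form f g"
    and F: "\<And>w v g. w \<in> space M \<Longrightarrow> v \<in> space (N w) \<Longrightarrow> ipH (F w v) g = ipK (L w v f) (L w v (R g))"
    and x: "\<And>g. ipH x g = ipH (S f) (R g)"
  shows "has_weak_integral M N ipH F x"
  unfolding has_weak_integral_def
proof (intro allI conjI)
  fix g
  note int = iterated_integrableD[OF ip_L_integrable[of f "R g"]]
  have inner: "(LINT v|N w. ipH (F w v) g) = (LINT v|N w. ipK (L w v f) (L w v (R g)))"
    if "w \<in> space M" for w
    using F[OF that] by (intro Bochner_Integration.integral_cong) auto
  show "AE w in M. integrable (N w) (\<lambda>v. ipH (F w v) g)"
    using int(1) AE_space
    by eventually_elim (simp add: F cong: Bochner_Integration.integrable_cong)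
  show "integrable M (\<lambda>w. LINT v|N w. ipH (F w v) g)"
    using int(2) by (simp add: inner cong: Bochner_Integration.integrable_cong)
  have "(LINT w|M. LINT v|N w. ipH (F w v) g) = form f (R g)"
    unfolding form_def by (intro Bochner_Integration.integral_cong refl inner)
  then show "(LINT w|M. LINT v|N w. ipH (F w v) g) = ipH x g" by (simp add: x S)
qed

end

section \<open>The transformed relay fusion frame and its reconstruction formulas\<close>

lemma (in hilbert_space) has_weak_integral_unique:
  assumes "has_weak_integral M N ip F x" "has_weak_integral M N ip F y"
  shows "x = y"
  by (rule ip_eqI) (use assms in \<open>simp add: has_weak_integral_def\<close>)

text \<open>\<open>S'\<close> is a definite description and \<open>inv\<close> is total, so
  existence of the weak integral and bijectivity of \<open>S'\<close> are part of the claim. The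
  relay space of the new frame is all of \<open>'r\<close>, because \<open>inv S\<^sub>F\<close>
  need not map \<open>K w\<close> into itself.\<close>

theorem theorem3p2:
  fixes scH :: "'k::real_or_complex \<Rightarrow> 'h::{banach, second_countable_topology} \<Rightarrow> 'h"
    and ipH :: "'h \<Rightarrow> 'h \<Rightarrow> 'k"
    and scK :: "'k \<Rightarrow> 'r::banach \<Rightarrow> 'r"
    and ipK :: "'r \<Rightarrow> 'r \<Rightarrow> 'k"
    and M :: "'w measure" and N :: "'w \<Rightarrow> 'v measure" and T :: "('w \<times> 'v) measure"
    and K :: "'w \<Rightarrow> 'r set" and U :: "('w \<Rightarrow> 'r) \<Rightarrow> 'r"
    and W :: "'w \<Rightarrow> 'h set" and V :: "'w \<Rightarrow> 'v \<Rightarrow> 'r set"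
    and \<Lambda> :: "'w \<Rightarrow> 'h \<Rightarrow> 'r" and \<alpha> :: "'w \<Rightarrow> 'v \<Rightarrow> real"
    and I :: "'i set" and \<phi> :: "'i \<Rightarrow> 'r"
    and S\<^sub>F :: "'r \<Rightarrow> 'r" and V' :: "'w \<Rightarrow> 'v \<Rightarrow> 'r set" and \<Lambda>' :: "'w \<Rightarrow> 'v \<Rightarrow> 'h \<Rightarrow> 'r"
    and S' :: "'h \<Rightarrow> 'h"
  assumes "hilbert_space scH ipH"
    and "hilbert_space scK ipK"
    and "measurable_bundle M N T"
    and "direct_integral M scK ipK K U"
    and "relay_fusion_frame scH ipH scK ipK M N T K W V \<Lambda> \<alpha>"
    and "hilbert_frame ipK I \<phi>"
    and "S\<^sub>F = frame_operator scK ipK I \<phi>"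
    and "V' = (\<lambda>w v. inv S\<^sub>F ` V w v)"
    and "\<Lambda>' = (\<lambda>w v x. inv S\<^sub>F (orth_proj ipK (V w v) (\<Lambda> w x)))"
    and "S' = relay_frame_operator ipH ipK M N W V' \<Lambda>' \<alpha>"
  shows "relay_fusion_frame2 scH ipH scK ipK M N T (\<lambda>w. UNIV) W V' \<Lambda>' \<alpha> \<and>
    (\<forall>f. has_weak_integral M N ipH (relay_frame_integrand ipH ipK W V' \<Lambda>' \<alpha> f) (S' f)) \<and>
    bij S' \<and>
    (\<forall>f. has_weak_integral M N ipH
           (\<lambda>w v. (\<alpha> w v)\<^sup>2 *\<^sub>R inv S' (orth_proj ipH (W w)
              (adj ipH ipK (\<Lambda>' w v) (\<Lambda>' w v (orth_proj ipH (W w) f))))) f \<and>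
         has_weak_integral M N ipH
           (\<lambda>w v. (\<alpha> w v)\<^sup>2 *\<^sub>R orth_proj ipH (W w)
              (adj ipH ipK (\<Lambda>' w v) (\<Lambda>' w v (orth_proj ipH (W w) (inv S' f))))) f)"
proof -
  interpret H: hilbert_space scH ipH by fact
  interpret K: hilbert_space scK ipK by fact
  interpret measure_bundle M N T by unfold_locales fact
  obtain a where "positive_definite_op scK ipK (frame_operator scK ipK I \<phi>) a"
    using K.positive_definite_frame_operator[OF assms(6)] by blast
  then interpret F: positive_definite_op scK ipK S\<^sub>F a by (simp only: assms(7))
  note V' = assms(8) and \<Lambda>' = assms(9)
  let ?\<pi> = "\<lambda>w. orth_proj ipH (W w)" and ?P = "\<lambda>w v. orth_proj ipK (V w v)"

  note frame = assms(5)[unfolded relay_fusion_frame_def relay_fusion_frame2_def]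
  have W: "closed_subspace scH (W w)" and \<Lambda>: "bounded_op scH scK (\<Lambda> w)" if "w \<in> space M" for w
    using frame that by blast+
  have V: "closed_subspace scK (V w v)" and \<alpha>: "0 < \<alpha> w v"
    if "w \<in> space M" "v \<in> space (N w)" for w v
    using frame that by blast+
  have \<alpha>_meas: "(\<lambda>(w, v). \<alpha> w v) \<in> borel_measurable T"
    and \<Lambda>_meas: "strongly_measurable T (\<lambda>(w, v). \<Lambda> w f)"
    and \<pi>_meas: "strongly_measurable M (\<lambda>w. ?\<pi> w f)"
    and P_meas: "strongly_measurable T (\<lambda>(w, v). ?P w v x)" for f x
    using frame by blast+
  define E where "E f = (\<integral>\<^sup>+w. \<integral>\<^sup>+v. ennreal ((\<alpha> w v)\<^sup>2 * (norm (?P w v (\<Lambda> w (?\<pi> w f))))\<^sup>2) \<partial>N w \<partial>M)" for f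
  obtain A B where A: "0 < A" and E: "\<And>f. ennreal (A * (norm f)\<^sup>2) \<le> E f" "\<And>f. E f \<le> ennreal (B * (norm f)\<^sup>2)"
    using frame unfolding E_def by blast

  have bounded_\<Lambda>': "bounded_op scH scK (\<Lambda>' w v)" if "w \<in> space M" "v \<in> space (N w)" for w v
    unfolding \<Lambda>'
    by (intro bounded_op_compose[OF assms(1,2,2) _ F.bounded_inv]
        bounded_op_compose[OF assms(1,2,2) \<Lambda>[OF that(1)] K.bounded_op_orth_proj[OF V[OF that]]])
  have bl_\<Lambda>: "bounded_linear (\<Lambda> w)" and bl_\<pi>: "bounded_linear (?\<pi> w)" if "w \<in> space M" for w
    using bounded_op_bounded_linear[OF assms(1,2) \<Lambda>[OF that]]
      bounded_op_bounded_linear[OF assms(1,1) H.bounded_op_orth_proj[OF W[OF that]]] by simp_all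
  have bl_P: "bounded_linear (?P w v)" if "w \<in> space M" "v \<in> space (N w)" for w v
    by (rule bounded_op_bounded_linear[OF assms(2,2) K.bounded_op_orth_proj[OF V[OF that]]])
  have closed_V': "closed_subspace scK (V' w v)" if "w \<in> space M" "v \<in> space (N w)" for w v
    unfolding V' by (rule F.closed_subspace_inv_image[OF V[OF that]])
  have P'_\<Lambda>': "orth_proj ipK (V' w v) (\<Lambda>' w v x) = \<Lambda>' w v x" if "w \<in> space M" "v \<in> space (N w)" for w v x
    by (rule K.orth_proj_ident[OF closed_V'[OF that]])
      (simp add: V' \<Lambda>' K.orth_proj_mem[OF V[OF that]])

  \<comment> \<open>Measurability of the transformed operators and projections\<close>
  have P_compose: "strongly_measurable T (\<lambda>(w, v). ?P w v (g (w, v)))" if "strongly_measurable T g" for g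
    using strongly_measurable_compose[of T "\<lambda>y x. ?P (fst x) (snd x) y" g] P_meas that
      linear_continuous_on[OF bl_P] in_space_TD
    by (simp add: case_prod_beta')
  have \<Lambda>_\<pi>_meas: "strongly_measurable T (\<lambda>(w, v). \<Lambda> w (?\<pi> w f))" for f
    using strongly_measurable_compose[of T "\<lambda>y x. \<Lambda> (fst x) y" "\<lambda>x. ?\<pi> (fst x) f"] \<Lambda>_meas
      strongly_measurable_pullback[OF fst_measurable \<pi>_meas] linear_continuous_on[OF bl_\<Lambda>] in_space_TD
    by (simp add: case_prod_beta')
  have cont_inv: "continuous_on UNIV (inv S\<^sub>F)"
    by (rule linear_continuous_on[OF F.bounded_linear_inv])
  have \<Lambda>'_meas: "strongly_measurable T (\<lambda>(w, v). \<Lambda>' w v f)" for f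
    using strongly_measurable_continuous[OF cont_inv P_compose[OF \<Lambda>_meas[of f]]]
    by (simp add: \<Lambda>' case_prod_beta')
  have V'_meas: "strongly_measurable T (\<lambda>(w, v). orth_proj ipK (V' w v) x)" for x
    using F.strongly_measurable_orth_proj_inv_image[of T "\<lambda>x. V (fst x) (snd x)" x] V in_space_TD P_meas
    by (simp add: V' case_prod_beta')

  \<comment> \<open>Comparison of the frame integrals\<close>
  define L where "L w v f = \<alpha> w v *\<^sub>R \<Lambda>' w v (?\<pi> w f)" for w v f
  define E' where "E' f = (\<integral>\<^sup>+w. \<integral>\<^sup>+v. ennreal ((norm (L w v f))\<^sup>2) \<partial>N w \<partial>M)" for f
  have L_meas: "strongly_measurable T (\<lambda>(w, v). L w v f)" for f
    using strongly_measurable_scaleR[OF \<alpha>_meas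
        strongly_measurable_continuous[OF cont_inv P_compose[OF \<Lambda>_\<pi>_meas[of f]]]]
    by (simp add: L_def \<Lambda>' case_prod_beta')
  have E_meas: "(\<lambda>(w, v). ennreal ((\<alpha> w v)\<^sup>2 * (norm (?P w v (\<Lambda> w (?\<pi> w f))))\<^sup>2)) \<in> borel_measurable T" for f
  proof -
    have [measurable]: "(\<lambda>x. ?P (fst x) (snd x) (\<Lambda> (fst x) (?\<pi> (fst x) f))) \<in> borel_measurable T"
      using strongly_measurable_borel[OF P_compose[OF \<Lambda>_\<pi>_meas[of f]]] by (simp add: case_prod_beta')
    have [measurable]: "(\<lambda>x. \<alpha> (fst x) (snd x)) \<in> borel_measurable T"
      using \<alpha>_meas by (simp add: case_prod_beta')
    show ?thesis unfolding case_prod_beta' by measurable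
  qed
  obtain m where m: "0 < m" "\<And>x. m * norm x \<le> norm (inv S\<^sub>F x)" using F.norm_inv_ge by blast
  \<comment> \<open>The factors are the squared lower and upper bounds of
    \<open>inv S\<^sub>F\<close>; the maximum in \<open>B'\<close> secures
    \<open>A' \<le> B'\<close> even on the zero space.\<close>
  define A' where "A' = m\<^sup>2 * A"
  define B' where "B' = max A' ((1 / a)\<^sup>2 * B)"
  have A': "0 < A'" using m A by (simp add: A'_def)
  have E'_lower: "ennreal (A' * (norm f)\<^sup>2) \<le> E' f" for f
  proof -
    have "ennreal (A' * (norm f)\<^sup>2) = ennreal (m\<^sup>2) * ennreal (A * (norm f)\<^sup>2)"
      using A by (simp add: A'_def mult.assoc flip: ennreal_mult)
    also have "\<dots> \<le> ennreal (m\<^sup>2) * E f" by (intro mult_left_mono E) simp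
    also have "\<dots> \<le> E' f"
      unfolding E_def E'_def nn_integral2_cmult[OF E_meas, symmetric]
    proof (rule nn_integral2_mono)
      fix w v
      let ?y = "?P w v (\<Lambda> w (?\<pi> w f))"
      have "(m * norm ?y)\<^sup>2 \<le> (norm (inv S\<^sub>F ?y))\<^sup>2" using m by (intro power_mono) auto
      then have "(\<alpha> w v)\<^sup>2 * (m * norm ?y)\<^sup>2 \<le> (\<alpha> w v)\<^sup>2 * (norm (inv S\<^sub>F ?y))\<^sup>2"
        by (rule mult_left_mono) simp
      then show "ennreal (m\<^sup>2) * ennreal ((\<alpha> w v)\<^sup>2 * (norm ?y)\<^sup>2) \<le> ennreal ((norm (L w v f))\<^sup>2)"
        by (simp add: L_def \<Lambda>' power_mult_distrib mult_ac flip: ennreal_mult)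
    qed
    finally show ?thesis .
  qed
  have E'_upper: "E' f \<le> ennreal (B' * (norm f)\<^sup>2)" for f
  proof -
    have "E' f \<le> ennreal ((1 / a)\<^sup>2) * E f"
      unfolding E_def E'_def nn_integral2_cmult[OF E_meas, symmetric]
    proof (rule nn_integral2_mono)
      fix w v
      let ?y = "?P w v (\<Lambda> w (?\<pi> w f))"
      have "(norm (inv S\<^sub>F ?y))\<^sup>2 \<le> ((1 / a) * norm ?y)\<^sup>2"
        by (intro power_mono F.norm_inv_le) simp
      then have "(\<alpha> w v)\<^sup>2 * (norm (inv S\<^sub>F ?y))\<^sup>2 \<le> (\<alpha> w v)\<^sup>2 * ((1 / a) * norm ?y)\<^sup>2"
        by (rule mult_left_mono) simp
      then show "ennreal ((norm (L w v f))\<^sup>2) \<le> ennreal ((1 / a)\<^sup>2) * ennreal ((\<alpha> w v)\<^sup>2 * (norm ?y)\<^sup>2)"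
        by (simp add: L_def \<Lambda>' power_divide power_mult_distrib mult_ac flip: ennreal_mult)
    qed
    also have "\<dots> \<le> ennreal ((1 / a)\<^sup>2) * ennreal (B * (norm f)\<^sup>2)" by (intro mult_left_mono E) simp
    also have "\<dots> = ennreal ((1 / a)\<^sup>2 * B * (norm f)\<^sup>2)" by (simp add: mult.assoc flip: ennreal_mult')
    also have "\<dots> \<le> ennreal (B' * (norm f)\<^sup>2)"
      by (intro ennreal_leI mult_right_mono) (simp_all add: B'_def)
    finally show ?thesis .
  qed

  \<comment> \<open>The frame operator and the weak integral defining it\<close>
  interpret operator_frame scH ipH scK ipK M N T L A' B'
  proof unfold_locales
    fix w v f g c
    assume wv: "w \<in> space M" "v \<in> space (N w)"
    show "L w v (f + g) = L w v f + L w v g"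
      by (simp add: L_def H.orth_proj_add[OF W[OF wv(1)]] bounded_op_simps[OF bounded_\<Lambda>'[OF wv]]
          scaleR_add_right)
    show "L w v (scH c f) = scK c (L w v f)"
      by (simp add: L_def H.orth_proj_scale[OF W[OF wv(1)]] bounded_op_simps[OF bounded_\<Lambda>'[OF wv]]
          K.scaleR_eq mult.commute)
  qed (fact L_meas A' E'_lower[unfolded E'_def] E'_upper[unfolded E'_def])+

  obtain S where S: "positive_definite_op scH ipH S A'" "\<And>f g. ipH (S f) g = form f g"
    using frame_operator_exists by blast
  interpret S: positive_definite_op scH ipH S A' by fact

  \<comment> \<open>Projection and adjoint move across the inner product, and the squared weight is
    shared out, one factor to each \<open>L\<close>.\<close>
  have core: "ipH ((\<alpha> w v)\<^sup>2 *\<^sub>R ?\<pi> w (adj ipH ipK (\<Lambda>' w v) (\<Lambda>' w v (?\<pi> w f)))) g = ipK (L w v f) (L w v g)"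
    if "w \<in> space M" "v \<in> space (N w)" for w v f g
    by (simp add: L_def H.ip_scaleR_left K.ip_scaleR_left K.ip_scaleR_right H.ip_orth_proj[OF W[OF that(1)]]
        ip_adj_left[OF assms(1,2) bounded_\<Lambda>'[OF that]] power2_eq_square)
  have integral: "has_weak_integral M N ipH (relay_frame_integrand ipH ipK W V' \<Lambda>' \<alpha> f) (S f)" for f
    by (rule has_weak_integral_frame_operator[where R = id and f = f, OF S(2)])
      (simp_all add: relay_frame_integrand_def P'_\<Lambda>' core)
  have S': "S' = S"
  proof
    fix f
    show "S' f = S f"
      unfolding assms(10) relay_frame_operator_def
      by (rule the_equality) (use integral H.has_weak_integral_unique in blast)+
  qed

  have "relay_fusion_frame2 scH ipH scK ipK M N T (\<lambda>w. UNIV) W V' \<Lambda>' \<alpha>"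
    unfolding relay_fusion_frame2_def
  proof (intro conjI)
    have "E' f = (\<integral>\<^sup>+w. \<integral>\<^sup>+v. ennreal ((\<alpha> w v)\<^sup>2 *
        (norm (orth_proj ipK (V' w v) (\<Lambda>' w v (?\<pi> w f))))\<^sup>2) \<partial>N w \<partial>M)" for f
      unfolding E'_def by (intro nn_integral_cong) (simp add: P'_\<Lambda>' L_def power_mult_distrib)
    then show "\<exists>A B. 0 < A \<and> A \<le> B \<and> (\<forall>f.
       ennreal (A * (norm f)\<^sup>2) \<le> (\<integral>\<^sup>+w. \<integral>\<^sup>+v. ennreal ((\<alpha> w v)\<^sup>2 *
            (norm (orth_proj ipK (V' w v) (\<Lambda>' w v (?\<pi> w f))))\<^sup>2) \<partial>N w \<partial>M) \<and>
       (\<integral>\<^sup>+w. \<integral>\<^sup>+v. ennreal ((\<alpha> w v)\<^sup>2 *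
            (norm (orth_proj ipK (V' w v) (\<Lambda>' w v (?\<pi> w f))))\<^sup>2) \<partial>N w \<partial>M) \<le> ennreal (B * (norm f)\<^sup>2))"
      using A' E'_lower E'_upper by (intro exI[of _ A'] exI[of _ B']) (simp add: B'_def)
    have "closed_subspace scK UNIV" by (simp add: closed_subspace_def)
    then show "\<forall>w\<in>space M. closed_subspace scH (W w) \<and> closed_subspace scK UNIV" using W by blast
    show "\<forall>w\<in>space M. \<forall>v\<in>space (N w). closed_subspace scK (V' w v) \<and> V' w v \<subseteq> UNIV \<and>
        bounded_op scH scK (\<Lambda>' w v) \<and> range (\<Lambda>' w v) \<subseteq> UNIV \<and> 0 < \<alpha> w v"
      using closed_V' bounded_\<Lambda>' \<alpha> by blast
  qed (use \<alpha>_meas \<Lambda>'_meas \<pi>_meas V'_meas in blast)+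
  moreover have "has_weak_integral M N ipH
      (\<lambda>w v. (\<alpha> w v)\<^sup>2 *\<^sub>R inv S (?\<pi> w (adj ipH ipK (\<Lambda>' w v) (\<Lambda>' w v (?\<pi> w f))))) f" for f
  proof (rule has_weak_integral_frame_operator[where R = "inv S" and f = f, OF S(2)])
    show "ipH f g = ipH (S f) (inv S g)" for g by (simp add: S.self_adjoint)
    show "ipH ((\<alpha> w v)\<^sup>2 *\<^sub>R inv S (?\<pi> w (adj ipH ipK (\<Lambda>' w v) (\<Lambda>' w v (?\<pi> w f))))) g
        = ipK (L w v f) (L w v (inv S g))" if "w \<in> space M" "v \<in> space (N w)" for w v g
      using core[OF that, of f "inv S g"] by (simp add: H.ip_scaleR_left S.inv_self_adjoint)
  qed
  moreover have "has_weak_integral M N ipH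
      (\<lambda>w v. (\<alpha> w v)\<^sup>2 *\<^sub>R ?\<pi> w (adj ipH ipK (\<Lambda>' w v) (\<Lambda>' w v (?\<pi> w (inv S f))))) f" for f
    by (rule has_weak_integral_frame_operator[where R = id and f = "inv S f", OF S(2)])
      (simp_all add: core)
  ultimately show ?thesis
    unfolding S' using integral S.bij by blast
qed

end
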